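(* Let $T\in\mathcal F$ be a trigraph with no balanced skew-partition. Then a set $X\subseteq V(T)$ is a weak fragment of $T$ if and only if $X$ is a proper fragment of $T$.
   Context: Trigraphs: finite $V(T)$ with $\theta:\binom{V(T)}{2}\to\{-1,0,1\}$; $u,v$ strongly adjacent if $\theta(uv)=1$, strongly antiadjacent if $-1$, a switchable pair if $0$; adjacent (neighbours) if $\theta\in\{0,1\}$, antiadjacent (antineighbours) if $\theta\in\{-1,0\}$. Complement $\overline T$: $-\theta$; $T|X$: induced trigraph. Strongly complete/anticomplete: strongly adjacent/antiadjacent to every vertex of a set. Full realization: graph on $V(T)$ of adjacent pairs. $X$ connected: full realization of $T|X$ connected; anticonnected: complement of graph on $X$ of strongly adjacent pairs connected; components = maximal connected subsets. Path: distinct $p_1,\dots,p_k$, consecutive adjacent, non-consecutive antiadjacent (length $k-1$, interior = inner vertices). Hole: $h_1,\dots,h_k$, $k\ge4$, $h_i,h_j$ adjacent iff $|i-j|\in\{1,k-1\}$, else antiadjacent. Antipath/antihole: complement is a path/hole in $\overline T$. Berge: no odd hole, no odd antihole. Skew-partition: partition $(A,B)$ of $V(T)$, $A$ not connected, $B$ not anticonnected; balanced if no path of odd length $>1$ with ends in $B$ and interior in $A$ and no antipath of odd length $>1$ with ends in $A$ and interior in $B$. $\mathcal F$: Berge trigraphs such that each component of the graph $\Sigma(T)$ of switchable pairs has at most two edges and each vertex $v$ of $\Sigma(T)$-degree two with $\Sigma(T)$-neighbours $x,y$ is either strongly complete to $V(T)\setminus\{v,x,y\}$ with $x,y$ strongly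 adjacent, or strongly anticomplete to $V(T)\setminus\{v,x,y\}$ with $x,y$ strongly antiadjacent. $2$-join: partition $(X_1,X_2)$ with disjoint $A_1,B_1,C_1,A_2,B_2,C_2$, $X_i=A_i\cup B_i\cup C_i$, $A_i,B_i\neq\emptyset$, no switchable pair between $X_1,X_2$, $A_1$ strongly complete to $A_2$, $B_1$ strongly complete to $B_2$, all other pairs between $X_1,X_2$ strongly antiadjacent, $|X_i|\ge3$, and if $|A_i|=|B_i|=1$ the full realization of $T|X_i$ is not a path of length two between the vertices of $A_i$ and $B_i$; proper if each component of $T|X_i$ meets $A_i$ and $B_i$. (Proper) complement $2$-join: (proper) $2$-join of $\overline T$. Proper homogeneous pair: disjoint nonempty $A,B\subseteq V(T)$ such that, letting $A_1$ ($A_2$) be the set of vertices of $V(T)\setminus(A\cup B)$ strongly complete (strongly anticomplete) to $A$ and $B_1,B_2$ likewise for $B$: $|A|>1$, $|B|>1$; $A_1\cup A_2=B_1\cup B_2=V(T)\setminus(A\cup B)$; every vertex of $A$ has a neighbour and an antineighbour in $B$ and vice versa; and $A_1\cap B_1,A_1\cap B_2,A_2\cap B_1,A_2\cap B_2$ are nonempty. Proper fragment: $X\subseteq V(T)$ such that $(X,V(T)\setminus X)$ is a proper $2$-join or proper complement $2$-join of $T$, or $X=A\cup B$ for a proper homogeneous pair $(A,B)$. Weak fragment: $X\subseteq V(T)$ for which there are disjoint sets $A_1,B_1,C_1,D_1,A_2,B_2,C_2,D_2$ with $X=A_1\cup B_1\cup C_1\cup D_1$, $V(T)\setminus X=A_2\cup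 B_2\cup C_2\cup D_2$, $A_1$ strongly complete to $A_2\cup D_2$ and strongly anticomplete to $B_2\cup C_2$, $B_1$ strongly complete to $B_2\cup D_2$ and strongly anticomplete to $A_2\cup C_2$, $C_1$ strongly anticomplete to $A_2\cup B_2\cup C_2$, $D_1$ strongly complete to $A_2\cup B_2\cup D_2$, $|X|\ge4$, $|V(T)\setminus X|\ge4$, $|A_i|,|B_i|\ge1$ for $i=1,2$, and at least one of: ($C_1=D_1=\emptyset$, $C_2\neq\emptyset$, $D_2\neq\emptyset$), or $D_1=D_2=\emptyset$, or $C_1=C_2=\emptyset$. *)

theory Defs
  imports Main
begin

text \<open>The function \<open>theta\<close> is applied to two-element subsets of \<open>verts\<close>; its values on all other
  sets are irrelevant.\<close>

record 'a trigraph =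
  verts :: "'a set"
  theta :: "'a set \<Rightarrow> int"

definition trigraph :: "'a trigraph \<Rightarrow> bool" where
  "trigraph T \<longleftrightarrow> finite (verts T) \<and>
     (\<forall>u\<in>verts T. \<forall>v\<in>verts T. u \<noteq> v \<longrightarrow> theta T {u, v} \<in> {-1, 0, 1})"

definition strongly_adjacent :: "'a trigraph \<Rightarrow> 'a \<Rightarrow> 'a \<Rightarrow> bool" where
  "strongly_adjacent T u v \<longleftrightarrow>
     u \<in> verts T \<and> v \<in> verts T \<and> u \<noteq> v \<and> theta T {u, v} = 1"

definition strongly_antiadjacent :: "'a trigraph \<Rightarrow> 'a \<Rightarrow> 'a \<Rightarrow> bool" where
  "strongly_antiadjacent T u v \<longleftrightarrow>
     u \<in> verts T \<and> v \<in> verts T \<and> u \<noteq> v \<and> theta T {u, v} = -1"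

definition switchable :: "'a trigraph \<Rightarrow> 'a \<Rightarrow> 'a \<Rightarrow> bool" where
  "switchable T u v \<longleftrightarrow>
     u \<in> verts T \<and> v \<in> verts T \<and> u \<noteq> v \<and> theta T {u, v} = 0"

definition adjacent :: "'a trigraph \<Rightarrow> 'a \<Rightarrow> 'a \<Rightarrow> bool" where
  "adjacent T u v \<longleftrightarrow>
     u \<in> verts T \<and> v \<in> verts T \<and> u \<noteq> v \<and> theta T {u, v} \<in> {0, 1}"

definition antiadjacent :: "'a trigraph \<Rightarrow> 'a \<Rightarrow> 'a \<Rightarrow> bool" where
  "antiadjacent T u v \<longleftrightarrow>
     u \<in> verts T \<and> v \<in> verts T \<and> u \<noteq> v \<and> theta T {u, v} \<in> {-1, 0}"

definition complement :: "'a trigraph \<Rightarrow> 'a trigraph" where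
  "complement T = \<lparr>verts = verts T, theta = (\<lambda>e. - theta T e)\<rparr>"

definition induced :: "'a trigraph \<Rightarrow> 'a set \<Rightarrow> 'a trigraph" where
  "induced T X = \<lparr>verts = X, theta = theta T\<rparr>"

definition strongly_complete :: "'a trigraph \<Rightarrow> 'a set \<Rightarrow> 'a set \<Rightarrow> bool" where
  "strongly_complete T A B \<longleftrightarrow> (\<forall>a\<in>A. \<forall>b\<in>B. strongly_adjacent T a b)"

definition strongly_anticomplete :: "'a trigraph \<Rightarrow> 'a set \<Rightarrow> 'a set \<Rightarrow> bool" where
  "strongly_anticomplete T A B \<longleftrightarrow> (\<forall>a\<in>A. \<forall>b\<in>B. strongly_antiadjacent T a b)"

text \<open>A graph is given by a vertex set and a symmetric edge relation, of which only the part on the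
  vertex set matters. The empty graph counts as connected, so both sides of a skew-partition are
  nonempty; components are nonempty.\<close>

definition graph_connected :: "'a set \<Rightarrow> ('a \<Rightarrow> 'a \<Rightarrow> bool) \<Rightarrow> bool" where
  "graph_connected V E \<longleftrightarrow>
     (\<forall>u\<in>V. \<forall>v\<in>V. (u, v) \<in> {(x, y). x \<in> V \<and> y \<in> V \<and> E x y}\<^sup>*)"

definition graph_component :: "'a set \<Rightarrow> ('a \<Rightarrow> 'a \<Rightarrow> bool) \<Rightarrow> 'a set \<Rightarrow> bool" where
  "graph_component V E K \<longleftrightarrow>
     K \<subseteq> V \<and> K \<noteq> {} \<and> graph_connected K E \<and>
     (\<forall>K'. K \<subseteq> K' \<and> K' \<subseteq> V \<and> graph_connected K' E \<longrightarrow> K' = K)"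

definition tri_connected :: "'a trigraph \<Rightarrow> 'a set \<Rightarrow> bool" where
  "tri_connected T X \<longleftrightarrow> graph_connected X (adjacent (induced T X))"

definition tri_anticonnected :: "'a trigraph \<Rightarrow> 'a set \<Rightarrow> bool" where
  "tri_anticonnected T X \<longleftrightarrow>
     graph_connected X (\<lambda>u v. u \<noteq> v \<and> \<not> strongly_adjacent (induced T X) u v)"

definition tri_component :: "'a trigraph \<Rightarrow> 'a set \<Rightarrow> bool" where
  "tri_component T K \<longleftrightarrow> graph_component (verts T) (adjacent T) K"

definition is_path :: "'a trigraph \<Rightarrow> 'a list \<Rightarrow> bool" where
  "is_path T ps \<longleftrightarrow> ps \<noteq> [] \<and> distinct ps \<and> set ps \<subseteq> verts T \<and>
     (\<forall>i j. i < j \<and> j < length ps \<longrightarrow>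
        (if j - i = 1 then adjacent T (ps ! i) (ps ! j)
         else antiadjacent T (ps ! i) (ps ! j)))"

abbreviation path_length :: "'a list \<Rightarrow> nat" where
  "path_length ps \<equiv> length ps - 1"

abbreviation path_interior :: "'a list \<Rightarrow> 'a set" where
  "path_interior ps \<equiv> set (butlast (tl ps))"

text \<open>As for paths, a switchable pair may serve as an edge or as a non-edge of a hole: chords are
  antiadjacent, not necessarily strongly antiadjacent.\<close>

definition is_hole :: "'a trigraph \<Rightarrow> 'a list \<Rightarrow> bool" where
  "is_hole T hs \<longleftrightarrow> length hs \<ge> 4 \<and> distinct hs \<and> set hs \<subseteq> verts T \<and>
     (\<forall>i j. i < j \<and> j < length hs \<longrightarrow>
        (if j - i \<in> {1, length hs - 1} then adjacent T (hs ! i) (hs ! j)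
         else antiadjacent T (hs ! i) (hs ! j)))"

definition is_antipath :: "'a trigraph \<Rightarrow> 'a list \<Rightarrow> bool" where
  "is_antipath T ps \<longleftrightarrow> is_path (complement T) ps"

definition is_antihole :: "'a trigraph \<Rightarrow> 'a list \<Rightarrow> bool" where
  "is_antihole T hs \<longleftrightarrow> is_hole (complement T) hs"

definition Berge :: "'a trigraph \<Rightarrow> bool" where
  "Berge T \<longleftrightarrow> \<not> (\<exists>hs. is_hole T hs \<and> odd (length hs)) \<and>
              \<not> (\<exists>hs. is_antihole T hs \<and> odd (length hs))"

definition skew_partition :: "'a trigraph \<Rightarrow> 'a set \<Rightarrow> 'a set \<Rightarrow> bool" where
  "skew_partition T A B \<longleftrightarrow> A \<union> B = verts T \<and> A \<inter> B = {} \<and>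
     \<not> tri_connected T A \<and> \<not> tri_anticonnected T B"

definition balanced_skew_partition :: "'a trigraph \<Rightarrow> 'a set \<Rightarrow> 'a set \<Rightarrow> bool" where
  "balanced_skew_partition T A B \<longleftrightarrow> skew_partition T A B \<and>
     \<not> (\<exists>ps. is_path T ps \<and> odd (path_length ps) \<and> path_length ps > 1 \<and>
            hd ps \<in> B \<and> last ps \<in> B \<and> path_interior ps \<subseteq> A) \<and>
     \<not> (\<exists>ps. is_antipath T ps \<and> odd (path_length ps) \<and> path_length ps > 1 \<and>
            hd ps \<in> A \<and> last ps \<in> A \<and> path_interior ps \<subseteq> B)"

definition trigraph_class_F :: "'a trigraph set" where
  "trigraph_class_F = {T. trigraph T \<and> Berge T \<and>
     (\<forall>K. graph_component (verts T) (switchable T) K \<longrightarrow>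
        card {{u, v} | u v. u \<in> K \<and> v \<in> K \<and> switchable T u v} \<le> 2) \<and>
     (\<forall>v\<in>verts T. \<forall>x y. x \<noteq> y \<and> {u. switchable T v u} = {x, y} \<longrightarrow>
        strongly_complete T {v} (verts T - {v, x, y}) \<and> strongly_adjacent T x y \<or>
        strongly_anticomplete T {v} (verts T - {v, x, y}) \<and> strongly_antiadjacent T x y)}"

abbreviation pairwise_disjoint :: "'a set list \<Rightarrow> bool" where
  "pairwise_disjoint \<equiv> sorted_wrt disjnt"

text \<open>One side \<open>X = A \<union> B \<union> C\<close> of a 2-join. The excluded path of length two is a path of the full
  realization, which is a graph, so its ends are non-adjacent in the trigraph.\<close>

definition two_join_side ::
    "'a trigraph \<Rightarrow> 'a set \<Rightarrow> 'a set \<Rightarrow> 'a set \<Rightarrow> 'a set \<Rightarrow> bool" where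
  "two_join_side T X A B C \<longleftrightarrow> X = A \<union> B \<union> C \<and> A \<noteq> {} \<and> B \<noteq> {} \<and> card X \<ge> 3 \<and>
     \<not> (\<exists>a b c. A = {a} \<and> B = {b} \<and> X = {a, b, c} \<and> distinct [a, b, c] \<and>
          adjacent T a c \<and> adjacent T c b \<and> \<not> adjacent T a b)"

definition two_join_split :: "'a trigraph \<Rightarrow> 'a set \<Rightarrow> 'a set \<Rightarrow>
    'a set \<Rightarrow> 'a set \<Rightarrow> 'a set \<Rightarrow> 'a set \<Rightarrow> 'a set \<Rightarrow> 'a set \<Rightarrow> bool" where
  "two_join_split T X1 X2 A1 B1 C1 A2 B2 C2 \<longleftrightarrow>
     X1 \<union> X2 = verts T \<and> X1 \<inter> X2 = {} \<and>
     pairwise_disjoint [A1, B1, C1, A2, B2, C2] \<and>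
     two_join_side T X1 A1 B1 C1 \<and> two_join_side T X2 A2 B2 C2 \<and>
     (\<forall>u\<in>X1. \<forall>v\<in>X2. \<not> switchable T u v) \<and>
     strongly_complete T A1 A2 \<and> strongly_complete T B1 B2 \<and>
     (\<forall>u\<in>X1. \<forall>v\<in>X2. \<not> (u \<in> A1 \<and> v \<in> A2) \<and> \<not> (u \<in> B1 \<and> v \<in> B2) \<longrightarrow>
        strongly_antiadjacent T u v)"

definition proper_two_join :: "'a trigraph \<Rightarrow> 'a set \<Rightarrow> 'a set \<Rightarrow> bool" where
  "proper_two_join T X1 X2 \<longleftrightarrow>
     (\<exists>A1 B1 C1 A2 B2 C2. two_join_split T X1 X2 A1 B1 C1 A2 B2 C2 \<and>
        (\<forall>K. tri_component (induced T X1) K \<longrightarrow> K \<inter> A1 \<noteq> {} \<and> K \<inter> B1 \<noteq> {}) \<and>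
        (\<forall>K. tri_component (induced T X2) K \<longrightarrow> K \<inter> A2 \<noteq> {} \<and> K \<inter> B2 \<noteq> {}))"

definition proper_complement_two_join :: "'a trigraph \<Rightarrow> 'a set \<Rightarrow> 'a set \<Rightarrow> bool" where
  "proper_complement_two_join T X1 X2 \<longleftrightarrow> proper_two_join (complement T) X1 X2"

definition proper_homogeneous_pair :: "'a trigraph \<Rightarrow> 'a set \<Rightarrow> 'a set \<Rightarrow> bool" where
  "proper_homogeneous_pair T A B \<longleftrightarrow>
     A \<subseteq> verts T \<and> B \<subseteq> verts T \<and> A \<noteq> {} \<and> B \<noteq> {} \<and> A \<inter> B = {} \<and>
     (let R = verts T - (A \<union> B);
          A1 = {v \<in> R. strongly_complete T {v} A};
          A2 = {v \<in> R. strongly_anticomplete T {v} A};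
          B1 = {v \<in> R. strongly_complete T {v} B};
          B2 = {v \<in> R. strongly_anticomplete T {v} B}
      in card A > 1 \<and> card B > 1 \<and> A1 \<union> A2 = R \<and> B1 \<union> B2 = R \<and>
         (\<forall>a\<in>A. (\<exists>b\<in>B. adjacent T a b) \<and> (\<exists>b\<in>B. antiadjacent T a b)) \<and>
         (\<forall>b\<in>B. (\<exists>a\<in>A. adjacent T b a) \<and> (\<exists>a\<in>A. antiadjacent T b a)) \<and>
         A1 \<inter> B1 \<noteq> {} \<and> A1 \<inter> B2 \<noteq> {} \<and> A2 \<inter> B1 \<noteq> {} \<and> A2 \<inter> B2 \<noteq> {})"

definition proper_fragment :: "'a trigraph \<Rightarrow> 'a set \<Rightarrow> bool" where
  "proper_fragment T X \<longleftrightarrow> X \<subseteq> verts T \<and>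
     (proper_two_join T X (verts T - X) \<or>
      proper_complement_two_join T X (verts T - X) \<or>
      (\<exists>A B. proper_homogeneous_pair T A B \<and> X = A \<union> B))"

definition weak_fragment :: "'a trigraph \<Rightarrow> 'a set \<Rightarrow> bool" where
  "weak_fragment T X \<longleftrightarrow> X \<subseteq> verts T \<and>
     (\<exists>A1 B1 C1 D1 A2 B2 C2 D2.
        pairwise_disjoint [A1, B1, C1, D1, A2, B2, C2, D2] \<and>
        X = A1 \<union> B1 \<union> C1 \<union> D1 \<and> verts T - X = A2 \<union> B2 \<union> C2 \<union> D2 \<and>
        strongly_complete T A1 (A2 \<union> D2) \<and> strongly_anticomplete T A1 (B2 \<union> C2) \<and>
        strongly_complete T B1 (B2 \<union> D2) \<and> strongly_anticomplete T B1 (A2 \<union> C2) \<and>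
        strongly_anticomplete T C1 (A2 \<union> B2 \<union> C2) \<and>
        strongly_complete T D1 (A2 \<union> B2 \<union> D2) \<and>
        card X \<ge> 4 \<and> card (verts T - X) \<ge> 4 \<and>
        card A1 \<ge> 1 \<and> card B1 \<ge> 1 \<and> card A2 \<ge> 1 \<and> card B2 \<ge> 1 \<and>
        (C1 = {} \<and> D1 = {} \<and> C2 \<noteq> {} \<and> D2 \<noteq> {} \<or>
         D1 = {} \<and> D2 = {} \<or>
         C1 = {} \<and> C2 = {}))"

end

theory Submission
  imports Defs
begin

text \<open>The main tool is that a Berge trigraph with a star cutset, whose centre is strongly complete to a
  nonempty remainder of the cutset, has a balanced skew-partition: after moving strong neighbours of
  the centre into the cutset, the centre would close any unbalanced path or antipath to an odd hole
  or antihole. A weak fragment without \<open>D\<close>-parts is a 2-join whose sides have at least four vertices,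
  and any failure of properness exhibits a star cutset; weak fragments without \<open>C\<close>-parts follow by
  complementation. If \<open>C1\<close> and \<open>D1\<close> are empty and some \<open>a\<close> in \<open>A1\<close> has no neighbour in \<open>B1\<close>, then
  \<open>(A1 - {a}) \<union> A2 \<union> D2\<close> is the non-anticonnected side of a balanced skew-partition (a star cutset
  works when \<open>A1 = {a}\<close>). Conversely, a proper fragment is weak except possibly for the size bound,
  and a side of a 2-join with three vertices yields a star cutset, an odd hole, or a forbidden vertex
  of degree two in the graph of switchable pairs.\<close>

section \<open>Complementation\<close>

lemma complement_simps [simp]:
  "verts (complement T) = verts T"
  "strongly_adjacent (complement T) = strongly_antiadjacent T"
  "strongly_antiadjacent (complement T) = strongly_adjacent T"
  "switchable (complement T) = switchable T"
  "adjacent (complement T) = antiadjacent T"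
  "antiadjacent (complement T) = adjacent T"
  "strongly_complete (complement T) = strongly_anticomplete T"
  "strongly_anticomplete (complement T) = strongly_complete T"
  "complement (complement T) = T"
  by (auto simp: complement_def strongly_adjacent_def strongly_antiadjacent_def switchable_def
      adjacent_def antiadjacent_def strongly_complete_def strongly_anticomplete_def fun_eq_iff)

lemma trigraph_complement [simp]: "trigraph (complement T) \<longleftrightarrow> trigraph T"
  by (auto simp: trigraph_def complement_def)

lemma Berge_complement [simp]: "Berge (complement T) \<longleftrightarrow> Berge T"
  by (auto simp: Berge_def is_antihole_def)

lemma trigraph_relation_sym:
  "strongly_adjacent T u v \<longleftrightarrow> strongly_adjacent T v u"
  "strongly_antiadjacent T u v \<longleftrightarrow> strongly_antiadjacent T v u"
  "switchable T u v \<longleftrightarrow> switchable T v u"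
  "adjacent T u v \<longleftrightarrow> adjacent T v u"
  "antiadjacent T u v \<longleftrightarrow> antiadjacent T v u"
  by (auto simp: strongly_adjacent_def strongly_antiadjacent_def switchable_def
      adjacent_def antiadjacent_def insert_commute)

lemma strongly_complete_sym: "strongly_complete T A B \<longleftrightarrow> strongly_complete T B A"
  unfolding strongly_complete_def by (metis trigraph_relation_sym(1))

lemma strongly_anticomplete_sym: "strongly_anticomplete T A B \<longleftrightarrow> strongly_anticomplete T B A"
  unfolding strongly_anticomplete_def by (metis trigraph_relation_sym(2))

lemma strongly_completeD:
  "strongly_complete T A B \<Longrightarrow> a \<in> A \<Longrightarrow> b \<in> B \<Longrightarrow> strongly_adjacent T a b"
  by (auto simp: strongly_complete_def)

lemma strongly_anticompleteD:
  "strongly_anticomplete T A B \<Longrightarrow> a \<in> A \<Longrightarrow> b \<in> B \<Longrightarrow> strongly_antiadjacent T a b"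
  by (auto simp: strongly_anticomplete_def)

lemma strongly_adjacent_imp:
  "strongly_adjacent T u v \<Longrightarrow> adjacent T u v \<and> \<not> antiadjacent T u v"
  by (auto simp: strongly_adjacent_def adjacent_def antiadjacent_def)

lemma strongly_antiadjacent_imp:
  "strongly_antiadjacent T u v \<Longrightarrow> antiadjacent T u v \<and> \<not> adjacent T u v"
  by (auto simp: strongly_antiadjacent_def adjacent_def antiadjacent_def)

lemma adjacent_cases:
  "adjacent T u v \<longleftrightarrow> strongly_adjacent T u v \<or> switchable T u v"
  "antiadjacent T u v \<longleftrightarrow> strongly_antiadjacent T u v \<or> switchable T u v"
  by (auto simp: strongly_adjacent_def strongly_antiadjacent_def switchable_def
      adjacent_def antiadjacent_def)

lemma not_adjacent_iff:
  assumes "trigraph T" "u \<in> verts T" "v \<in> verts T" "u \<noteq> v"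
  shows "\<not> adjacent T u v \<longleftrightarrow> strongly_antiadjacent T u v"
    and "\<not> antiadjacent T u v \<longleftrightarrow> strongly_adjacent T u v"
    and "\<not> strongly_adjacent T u v \<longleftrightarrow> antiadjacent T u v"
    and "\<not> strongly_antiadjacent T u v \<longleftrightarrow> adjacent T u v"
  using assms by (auto simp: trigraph_def strongly_adjacent_def strongly_antiadjacent_def
      adjacent_def antiadjacent_def)

section \<open>Paths that an extra vertex closes to an odd hole\<close>

lemma is_path_Cons:
  assumes "is_path T ps" "v \<notin> set ps" "adjacent T v (hd ps)" "\<forall>y\<in>set (tl ps). antiadjacent T v y"
  shows "is_path T (v # ps)"
proof -
  have ne: "ps \<noteq> []" using assms(1) by (simp add: is_path_def)
  have v: "v \<in> verts T" using assms(3) by (simp add: adjacent_def)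
  have "if j - i = 1 then adjacent T ((v # ps) ! i) ((v # ps) ! j)
        else antiadjacent T ((v # ps) ! i) ((v # ps) ! j)"
    if ij: "i < j" "j < length (v # ps)" for i j
  proof (cases i)
    case 0
    obtain j' where j': "j = Suc j'" "j' < length ps" using ij 0 by (cases j) auto
    show ?thesis
    proof (cases j')
      case 0
      then show ?thesis using \<open>i = 0\<close> j' assms(3) ne by (simp add: hd_conv_nth)
    next
      case (Suc k)
      then have "ps ! j' \<in> set (tl ps)" using j'(2) ne by (cases ps) auto
      then show ?thesis using \<open>i = 0\<close> j' Suc assms(4) by simp
    qed
  next
    case (Suc i')
    then obtain j' where "j = Suc j'" using ij by (cases j) auto
    then show ?thesis using Suc ij assms(1) by (simp add: is_path_def)
  qed
  then have "\<forall>i j. i < j \<and> j < length (v # ps) \<longrightarrow>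
      (if j - i = 1 then adjacent T ((v # ps) ! i) ((v # ps) ! j)
       else antiadjacent T ((v # ps) ! i) ((v # ps) ! j))" by blast
  moreover have "distinct (v # ps)" "set (v # ps) \<subseteq> verts T"
    using assms(1,2) v by (auto simp: is_path_def)
  ultimately show ?thesis unfolding is_path_def by blast
qed

lemma is_path_rev:
  assumes "is_path T ps"
  shows "is_path T (rev ps)"
proof -
  have "if j - i = 1 then adjacent T (rev ps ! i) (rev ps ! j)
        else antiadjacent T (rev ps ! i) (rev ps ! j)"
    if ij: "i < j" "j < length ps" for i j
  proof -
    let ?n = "length ps"
    have "?n - Suc j < ?n - Suc i" "?n - Suc i < ?n"
      and d: "(?n - Suc i) - (?n - Suc j) = j - i" using ij by auto
    then have "if j - i = 1 then adjacent T (ps ! (?n - Suc j)) (ps ! (?n - Suc i))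
        else antiadjacent T (ps ! (?n - Suc j)) (ps ! (?n - Suc i))"
      using assms unfolding is_path_def by (metis d)
    then show ?thesis using ij by (auto simp: rev_nth trigraph_relation_sym split: if_splits)
  qed
  then show ?thesis using assms by (simp add: is_path_def)
qed

text \<open>The first set holds the interior, the second the ends. Both halves of balancedness are
  instances: the antipath half is this predicate for \<open>complement T\<close> with the two sets
  exchanged.\<close>

definition no_odd_path :: "'a trigraph \<Rightarrow> 'a set \<Rightarrow> 'a set \<Rightarrow> bool" where
  "no_odd_path T Y P \<longleftrightarrow> \<not> (\<exists>ps. is_path T ps \<and> odd (path_length ps) \<and> path_length ps > 1 \<and>
     hd ps \<in> P \<and> last ps \<in> P \<and> path_interior ps \<subseteq> Y)"

text \<open>An odd length above 1 is at least 3, so the path has an even number of vertices, at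
  least four. Writing that number as \<open>n + 4\<close> lets the ends \<open>0\<close>,
  \<open>n + 3\<close> and the outermost inner vertices \<open>1\<close>, \<open>n + 2\<close> be
  addressed without subtraction.\<close>

lemma odd_path_decompose:
  assumes "is_path T ps" "odd (path_length ps)" "path_length ps > 1"
  obtains n where "length ps = n + 4" "even n" "hd ps = ps ! 0" "last ps = ps ! (n + 3)"
    "path_interior ps = (!) ps ` {1..n+2}" "distinct ps" "set ps \<subseteq> verts T"
    "\<And>i. i < n + 3 \<Longrightarrow> adjacent T (ps ! i) (ps ! Suc i)"
    "\<And>i j. Suc i < j \<Longrightarrow> j < n + 4 \<Longrightarrow> antiadjacent T (ps ! i) (ps ! j)"
proof -
  define n where "n = length ps - 4"
  have "length ps \<ge> 4" using assms(2,3) by presburger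
  then have len: "length ps = n + 4" by (simp add: n_def)
  then have "even n" using assms(2) by simp
  moreover have "ps \<noteq> []" using len by auto
  then have "hd ps = ps ! 0" "last ps = ps ! (n + 3)"
    using len by (auto simp: hd_conv_nth last_conv_nth add.commute)
  moreover have "path_interior ps = (!) ps ` {1..n+2}"
  proof -
    have "path_interior ps = {butlast (tl ps) ! i |i. i < length (butlast (tl ps))}"
      by (rule set_conv_nth)
    also have "\<dots> = {ps ! Suc i |i. i < n + 2}"
    proof -
      have "butlast (tl ps) ! i = ps ! Suc i" if "i < n + 2" for i
        using that len by (simp add: nth_butlast nth_tl)
      moreover have "length (butlast (tl ps)) = n + 2" using len by simp
      ultimately show ?thesis by (metis (no_types, lifting))
    qed
    also have "\<dots> = (!) ps ` {1..n+2}"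
    proof -
      have "{1..n+2} = Suc ` {..<n+2}" using image_Suc_atLeastAtMost[of 0 "n+1"]
        by (auto simp: image_iff Bex_def) (metis Suc_le_D Suc_le_lessD less_Suc_eq_le)
      then show ?thesis by auto
    qed
    finally show ?thesis .
  qed
  moreover have "distinct ps" "set ps \<subseteq> verts T" using assms(1) by (auto simp: is_path_def)
  moreover have "adjacent T (ps ! i) (ps ! Suc i)" if "i < n + 3" for i
  proof -
    have "i < Suc i \<and> Suc i < length ps" using that len by simp
    then show ?thesis using assms(1) unfolding is_path_def
      by (metis One_nat_def Suc_diff_le diff_self_eq_0 le_refl)
  qed
  moreover have "antiadjacent T (ps ! i) (ps ! j)" if "Suc i < j" "j < n + 4" for i j
  proof -
    have "i < j \<and> j < length ps" "j - i \<noteq> 1" using that len by auto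
    then show ?thesis using assms(1) unfolding is_path_def by metis
  qed
  ultimately show ?thesis using that len by blast
qed

text \<open>Prepending \<open>v\<close> to a forbidden path with \<open>n + 4\<close> vertices,
  \<open>n\<close> even, gives a hole with \<open>n + 5\<close> vertices.\<close>

lemma no_odd_path_closing:
  assumes "Berge T" "\<forall>p\<in>P. adjacent T v p" "\<forall>y\<in>Y. antiadjacent T v y"
  shows "no_odd_path T Y P"
  unfolding no_odd_path_def
proof (rule notI, elim exE conjE)
  fix ps assume ps: "is_path T ps" "odd (path_length ps)" "path_length ps > 1"
    and ends: "hd ps \<in> P" "last ps \<in> P" "path_interior ps \<subseteq> Y"
  obtain n where n: "length ps = n + 4" "even n" "hd ps = ps ! 0" "last ps = ps ! (n + 3)"
    "path_interior ps = (!) ps ` {1..n+2}" "distinct ps" "set ps \<subseteq> verts T"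
    "\<And>i. i < n + 3 \<Longrightarrow> adjacent T (ps ! i) (ps ! Suc i)"
    "\<And>i j. Suc i < j \<Longrightarrow> j < n + 4 \<Longrightarrow> antiadjacent T (ps ! i) (ps ! j)"
    using odd_path_decompose[OF ps] by blast
  have v: "v \<in> verts T" using assms(2) ends(1) by (auto simp: adjacent_def)
  have inner: "antiadjacent T v (ps ! i)" if "1 \<le> i" "i \<le> n + 2" for i
    using that ends(3) n(5) assms(3) by (auto simp: image_subset_iff)
  have outer: "adjacent T v (ps ! 0)" "adjacent T v (ps ! (n + 3))"
    using ends n(3,4) assms(2) by auto
  \<comment> \<open>That \<open>v\<close> lies off the path is automatic, because
    \<open>adjacent\<close> and \<open>antiadjacent\<close> are irreflexive.\<close>
  have ne: "v \<noteq> ps ! i" if "i < n + 4" for i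
  proof -
    consider "i = 0" | "1 \<le> i \<and> i \<le> n + 2" | "i = n + 3" using \<open>i < n + 4\<close> by linarith
    then show ?thesis using inner[of i] outer by cases (auto simp: adjacent_def antiadjacent_def)
  qed
  have "is_hole T (v # ps)"
    unfolding is_hole_def
  proof (intro conjI allI impI)
    show "4 \<le> length (v # ps)" "set (v # ps) \<subseteq> verts T" using n v by auto
    show "distinct (v # ps)" using n(1,6) ne by (auto simp: in_set_conv_nth)
    fix i j assume "i < j \<and> j < length (v # ps)"
    then obtain j' where j: "j = Suc j'" "i < Suc j'" "j' < n + 4" using n(1) by (cases j) auto
    show "if j - i \<in> {1, length (v # ps) - 1} then adjacent T ((v # ps) ! i) ((v # ps) ! j)
       else antiadjacent T ((v # ps) ! i) ((v # ps) ! j)"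
    proof (cases i)
      case 0
      then show ?thesis using j inner[of j'] outer n(1)
        by (cases "j' = 0"; cases "j' = n + 3") (auto simp: add.commute)
    next
      case (Suc i')
      then show ?thesis using j n(1) n(8)[of i'] n(9)[of i' j'] by (cases "j' = Suc i'") auto
    qed
  qed
  moreover have "odd (length (v # ps))" using n by simp
  ultimately show False using assms(1) by (auto simp: Berge_def)
qed

text \<open>In the complement \<open>v\<close> is adjacent to all of \<open>Y\<close> and
  antiadjacent to all of \<open>P\<close>, so the same vertex also closes antipaths, with the roles
  of \<open>Y\<close> and \<open>P\<close> exchanged.\<close>

lemma no_odd_antipath_closing:
  assumes "Berge T" "\<forall>p\<in>P. adjacent T v p" "\<forall>y\<in>Y. antiadjacent T v y"
  shows "no_odd_path (complement T) P Y"
  using assms by (intro no_odd_path_closing) auto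

text \<open>The path has at least four distinct vertices, hence two distinct ends and two distinct
  inner vertices.\<close>

lemma no_odd_path_singleton:
  "no_odd_path T Y {v}" "no_odd_path T {v} P"
proof -
  show "no_odd_path T Y {v}"
    unfolding no_odd_path_def
  proof (rule notI, elim exE conjE)
    fix ps assume ps: "is_path T ps" "odd (path_length ps)" "path_length ps > 1"
      and ends: "hd ps \<in> {v}" "last ps \<in> {v}"
    obtain n where "length ps = n + 4" "hd ps = ps ! 0" "last ps = ps ! (n + 3)" "distinct ps"
      using odd_path_decompose[OF ps] by metis
    then show False using ends nth_eq_iff_index_eq[of ps 0 "n + 3"] by simp
  qed
  show "no_odd_path T {v} P"
    unfolding no_odd_path_def
  proof (rule notI, elim exE conjE)
    fix ps assume ps: "is_path T ps" "odd (path_length ps)" "path_length ps > 1"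
      and int: "path_interior ps \<subseteq> {v}"
    obtain n where n: "length ps = n + 4" "path_interior ps = (!) ps ` {1..n+2}" "distinct ps"
      using odd_path_decompose[OF ps] by metis
    have "ps ! 1 = v" "ps ! 2 = v" using n(2) int by (auto simp: image_subset_iff)
    then show False using n nth_eq_iff_index_eq[of ps 1 2] by simp
  qed
qed

section \<open>Balanced skew-partitions\<close>

lemma not_graph_connectedI:
  assumes "y \<in> Y" "z \<in> Z" "Y \<inter> Z = {}" "\<And>u v. u \<in> Y \<Longrightarrow> v \<in> Z \<Longrightarrow> \<not> E u v"
  shows "\<not> graph_connected (Y \<union> Z) E"
proof
  assume "graph_connected (Y \<union> Z) E"
  then have "(y, z) \<in> {(u, v). u \<in> Y \<union> Z \<and> v \<in> Y \<union> Z \<and> E u v}\<^sup>*"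
    using assms(1,2) by (auto simp: graph_connected_def)
  then have "z \<in> Y"
    by (induction rule: rtrancl_induct) (use assms in auto)
  then show False using assms by auto
qed

lemma induced_simps [simp]:
  "verts (induced T X) = X"
  "theta (induced T X) = theta T"
  by (simp_all add: induced_def)

text \<open>Consecutive inner vertices are adjacent, so the interior never crosses between
  \<open>Y\<close> and \<open>Z\<close>; the position of \<open>ps ! 1\<close> decides for all of
  them.\<close>

lemma path_interior_in_side:
  assumes ps: "is_path T ps" "odd (path_length ps)" "path_length ps > 1"
    and int: "path_interior ps \<subseteq> Y \<union> Z" and anti: "strongly_anticomplete T Y Z"
  shows "path_interior ps \<subseteq> Y \<or> path_interior ps \<subseteq> Z"
proof -
  obtain n where n: "path_interior ps = (!) ps ` {1..n+2}"
      "\<And>i. i < n + 3 \<Longrightarrow> adjacent T (ps ! i) (ps ! Suc i)"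
    using odd_path_decompose[OF ps] by metis
  have step: "ps ! Suc i \<in> W" if "ps ! i \<in> W" "1 \<le> i" "i < n + 2" "W = Y \<or> W = Z" for i W
  proof -
    have "ps ! Suc i \<in> path_interior ps" using n(1) that by auto
    then have "ps ! Suc i \<in> Y \<union> Z" using int by blast
    moreover have "adjacent T (ps ! i) (ps ! Suc i)" using n(2) that by simp
    moreover have "\<not> adjacent T u v" "\<not> adjacent T v u" if "u \<in> Y" "v \<in> Z" for u v
      using strongly_anticompleteD[OF anti that] strongly_antiadjacent_imp
        trigraph_relation_sym(4) by metis+
    ultimately show ?thesis using that by blast
  qed
  have all: "path_interior ps \<subseteq> W" if "ps ! 1 \<in> W" "W = Y \<or> W = Z" for W
  proof -
    have "ps ! i \<in> W" if "1 \<le> i" "i \<le> n + 2" for i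
      using that by (induction rule: dec_induct) (use \<open>ps ! 1 \<in> W\<close> \<open>W = Y \<or> W = Z\<close> step in auto)
    then show ?thesis using n(1) by auto
  qed
  have "ps ! 1 \<in> path_interior ps" using n(1) by auto
  then show ?thesis using int all by blast
qed

text \<open>The ends of a path of length above 1 are antiadjacent, which is impossible between
  \<open>P\<close> and \<open>Q\<close>.\<close>

lemma path_ends_in_side:
  assumes ps: "is_path T ps" "odd (path_length ps)" "path_length ps > 1"
    and ends: "hd ps \<in> P \<union> Q" "last ps \<in> P \<union> Q" and comp: "strongly_complete T P Q"
  shows "hd ps \<in> P \<and> last ps \<in> P \<or> hd ps \<in> Q \<and> last ps \<in> Q"
proof -
  obtain n where n: "hd ps = ps ! 0" "last ps = ps ! (n + 3)"
      "\<And>i j. Suc i < j \<Longrightarrow> j < n + 4 \<Longrightarrow> antiadjacent T (ps ! i) (ps ! j)"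
    using odd_path_decompose[OF ps] by metis
  have "antiadjacent T (hd ps) (last ps)" using n by simp
  moreover have "\<not> antiadjacent T u v" "\<not> antiadjacent T v u" if "u \<in> P" "v \<in> Q" for u v
    using strongly_completeD[OF comp that] strongly_adjacent_imp trigraph_relation_sym(5) by metis+
  ultimately show ?thesis using ends by blast
qed

lemma no_odd_path_union:
  assumes "strongly_anticomplete T Y Z" "strongly_complete T P Q"
    and "no_odd_path T Y P" "no_odd_path T Y Q" "no_odd_path T Z P" "no_odd_path T Z Q"
  shows "no_odd_path T (Y \<union> Z) (P \<union> Q)"
proof -
  have False
    if ps: "is_path T ps" "odd (path_length ps)" "path_length ps > 1"
      and "hd ps \<in> P \<union> Q" "last ps \<in> P \<union> Q" "path_interior ps \<subseteq> Y \<union> Z" for ps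
    using path_interior_in_side[OF ps that(6) assms(1)] path_ends_in_side[OF ps that(4,5) assms(2)]
      assms(3-6) ps unfolding no_odd_path_def by blast
  then show ?thesis unfolding no_odd_path_def by blast
qed

lemma balanced_skew_partition_iff:
  "balanced_skew_partition T A B \<longleftrightarrow>
     skew_partition T A B \<and> no_odd_path T A B \<and> no_odd_path (complement T) B A"
  unfolding balanced_skew_partition_def no_odd_path_def is_antipath_def by (rule refl)

text \<open>Splitting both sides of the partition reduces balancedness to eight conditions on one
  part of each side, every one of which can be met by its own closing vertex or by a
  singleton.\<close>

lemma balanced_skew_partitionI:
  assumes "verts T = Y \<union> Z \<union> (P \<union> Q)" "(Y \<union> Z) \<inter> (P \<union> Q) = {}"
    and "Y \<noteq> {}" "Z \<noteq> {}" "P \<noteq> {}" "Q \<noteq> {}"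
    and anti: "strongly_anticomplete T Y Z" and comp: "strongly_complete T P Q"
    and "no_odd_path T Y P" "no_odd_path T Y Q" "no_odd_path T Z P" "no_odd_path T Z Q"
    and "no_odd_path (complement T) P Y" "no_odd_path (complement T) P Z"
      "no_odd_path (complement T) Q Y" "no_odd_path (complement T) Q Z"
  shows "balanced_skew_partition T (Y \<union> Z) (P \<union> Q)"
proof -
  obtain y z p q where "y \<in> Y" "z \<in> Z" "p \<in> P" "q \<in> Q" using assms by blast
  have "\<not> tri_connected T (Y \<union> Z)" unfolding tri_connected_def
    by (rule not_graph_connectedI[OF \<open>y \<in> Y\<close> \<open>z \<in> Z\<close>])
      (use anti in \<open>auto simp: strongly_anticomplete_def strongly_antiadjacent_def adjacent_def\<close>)
  moreover have "\<not> tri_anticonnected T (P \<union> Q)" unfolding tri_anticonnected_def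
    by (rule not_graph_connectedI[OF \<open>p \<in> P\<close> \<open>q \<in> Q\<close>])
      (use comp in \<open>auto simp: strongly_complete_def strongly_adjacent_def\<close>)
  moreover have "no_odd_path T (Y \<union> Z) (P \<union> Q)"
    using assms by (intro no_odd_path_union)
  \<comment> \<open>Complementation exchanges complete and anticomplete, so \<open>P\<close>,
    \<open>Q\<close> now carry the interiors and \<open>Y\<close>, \<open>Z\<close> the
    ends.\<close>
  moreover have "no_odd_path (complement T) (P \<union> Q) (Y \<union> Z)"
    using assms by (intro no_odd_path_union) auto
  ultimately show ?thesis using assms(1,2)
    unfolding balanced_skew_partition_iff skew_partition_def by auto
qed

text \<open>The cutset splits as \<open>{v}\<close> and \<open>Q\<close>. Conditions involving
  \<open>{v}\<close> or a one-vertex side are trivial; in the others \<open>v\<close> is adjacent to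
  \<open>Q\<close> and antiadjacent to the side, so \<open>v\<close> is the closing vertex.\<close>

lemma star_cutset_balanced:
  assumes T: "trigraph T" "Berge T"
    and verts: "verts T = insert v (S \<union> Y \<union> Z)" "v \<notin> S \<union> Y \<union> Z" "S \<inter> (Y \<union> Z) = {}"
    and ne: "S \<noteq> {}" "Y \<noteq> {}" "Z \<noteq> {}"
    and star: "strongly_complete T {v} S" and anti: "strongly_anticomplete T Y Z"
  shows "\<exists>A B. balanced_skew_partition T A B"
proof -
  \<comment> \<open>Moving strong neighbours of the centre from a side into the cutset keeps the star a cutset as
    long as the side does not become empty.\<close>
  have shrink: "\<exists>W'. W' \<subseteq> W \<and> W' \<noteq> {} \<and> (\<forall>w\<in>W - W'. strongly_adjacent T v w) \<and>
      ((\<exists>w. W' = {w}) \<or> (\<forall>w\<in>W'. antiadjacent T v w))"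
    if W: "W \<noteq> {}" "W \<subseteq> verts T - {v}" for W
  proof (cases "\<exists>w\<in>W. \<not> strongly_adjacent T v w")
    case True
    have "antiadjacent T v w" if "w \<in> W" "\<not> strongly_adjacent T v w" for w
      using not_adjacent_iff(3)[of T v w] that W T verts by auto
    then show ?thesis using True by (intro exI[of _ "{w\<in>W. \<not> strongly_adjacent T v w}"]) auto
  next
    \<comment> \<open>If all of \<open>W\<close> is strongly adjacent to the centre, a single vertex
      is kept: the side stays nonempty and a singleton needs no closing vertex.\<close>
    case False
    obtain w where "w \<in> W" using W by blast
    then show ?thesis using False by (intro exI[of _ "{w}"]) auto
  qed
  obtain Y' where Y': "Y' \<subseteq> Y" "Y' \<noteq> {}" "\<forall>w\<in>Y - Y'. strongly_adjacent T v w"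
      "(\<exists>w. Y' = {w}) \<or> (\<forall>w\<in>Y'. antiadjacent T v w)"
    using shrink[of Y] ne verts by blast
  obtain Z' where Z': "Z' \<subseteq> Z" "Z' \<noteq> {}" "\<forall>w\<in>Z - Z'. strongly_adjacent T v w"
      "(\<exists>w. Z' = {w}) \<or> (\<forall>w\<in>Z'. antiadjacent T v w)"
    using shrink[of Z] ne verts by blast
  have disj: "Y \<inter> Z = {}"
    using anti by (auto simp: strongly_anticomplete_def strongly_antiadjacent_def)
  define Q where "Q = S \<union> (Y - Y') \<union> (Z - Z')"
  have Q: "strongly_complete T {v} Q"
    using star Y'(3) Z'(3) by (auto simp: Q_def strongly_complete_def)
  then have Qadj: "\<forall>q\<in>Q. adjacent T v q"
    using strongly_completeD strongly_adjacent_imp by fastforce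
  have side: "no_odd_path T W Q" "no_odd_path (complement T) Q W"
    if "(\<exists>w. W = {w}) \<or> (\<forall>w\<in>W. antiadjacent T v w)" for W
    using that no_odd_path_singleton no_odd_path_closing[OF T(2) Qadj]
      no_odd_antipath_closing[OF T(2) Qadj] by metis+
  have "balanced_skew_partition T (Y' \<union> Z') ({v} \<union> Q)"
  proof (rule balanced_skew_partitionI)
    show "verts T = Y' \<union> Z' \<union> ({v} \<union> Q)" "(Y' \<union> Z') \<inter> ({v} \<union> Q) = {}"
      using verts Y'(1) Z'(1) disj by (auto simp: Q_def)
    show "strongly_anticomplete T Y' Z'"
      using anti Y'(1) Z'(1) by (auto simp: strongly_anticomplete_def)
    show "Q \<noteq> {}" using ne by (simp add: Q_def)
  qed (simp_all add: Y'(2) Z'(2) Q no_odd_path_singleton side[OF Y'(4)] side[OF Z'(4)])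
  then show ?thesis by blast
qed

section \<open>Components and induced paths\<close>

lemma graph_component_exists:
  assumes "v \<in> V" and sym: "\<And>x y. E x y \<Longrightarrow> E y x"
  shows "\<exists>K. graph_component V E K \<and> v \<in> K"
proof -
  define rel where "rel W = {(x, y). x \<in> W \<and> y \<in> W \<and> E x y}" for W
  define K where "K = {w. (v, w) \<in> (rel V)\<^sup>*}"
  have symrel: "sym (rel W)" for W using sym by (auto simp: sym_def rel_def)
  have vK: "v \<in> K" by (simp add: K_def)
  have sub: "K \<subseteq> V"
  proof
    fix w assume "w \<in> K"
    then have "(v, w) \<in> (rel V)\<^sup>*" by (simp add: K_def)
    then show "w \<in> V" by (induction rule: rtrancl_induct) (use assms in \<open>auto simp: rel_def\<close>)
  qed
  \<comment> \<open>Connectedness of \<open>K\<close> asks for walks inside \<open>K\<close>,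
    whereas \<open>K\<close> was defined through walks in \<open>V\<close>.\<close>
  have reach: "(v, w) \<in> (rel K)\<^sup>*" if "w \<in> K" for w
  proof -
    have "(v, w) \<in> (rel V)\<^sup>*" using that by (simp add: K_def)
    then show ?thesis
    proof (induction rule: rtrancl_induct)
      case (step y z)
      then have "y \<in> K" "z \<in> K" by (auto simp: K_def)
      then have "(y, z) \<in> rel K" using step by (simp add: rel_def)
      then show ?case using step by simp
    qed simp
  qed
  have "graph_connected K E"
    unfolding graph_connected_def rel_def[symmetric]
  proof (intro ballI)
    fix x y assume "x \<in> K" "y \<in> K"
    then have "(x, v) \<in> (rel K)\<^sup>*" "(v, y) \<in> (rel K)\<^sup>*"
      using reach sym_rtrancl[OF symrel] by (auto dest: symD)
    then show "(x, y) \<in> (rel K)\<^sup>*" by (rule rtrancl_trans)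
  qed
  moreover have "K' = K" if "K \<subseteq> K'" "K' \<subseteq> V" "graph_connected K' E" for K'
  proof -
    have "rel K' \<subseteq> rel V" using that by (auto simp: rel_def)
    then have mono: "(rel K')\<^sup>* \<subseteq> (rel V)\<^sup>*" by (rule rtrancl_mono)
    have "w \<in> K" if "w \<in> K'" for w
    proof -
      have "(v, w) \<in> (rel K')\<^sup>*"
        using \<open>graph_connected K' E\<close> \<open>K \<subseteq> K'\<close> vK that unfolding graph_connected_def rel_def by blast
      then show ?thesis using mono by (auto simp: K_def)
    qed
    then show ?thesis using that by blast
  qed
  ultimately show ?thesis using vK sub unfolding graph_component_def by blast
qed

text \<open>Otherwise \<open>insert w K\<close> would be a larger connected set, against the
  maximality of \<open>K\<close>.\<close>

lemma graph_component_closed: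
  assumes K: "graph_component V E K" and sym: "\<And>x y. E x y \<Longrightarrow> E y x"
    and u: "u \<in> K" "w \<in> V" "E u w"
  shows "w \<in> K"
proof -
  define rel where "rel W = {(x, y). x \<in> W \<and> y \<in> W \<and> E x y}" for W
  have K': "K \<subseteq> V" "graph_connected K E"
    "\<And>K'. K \<subseteq> K' \<Longrightarrow> K' \<subseteq> V \<Longrightarrow> graph_connected K' E \<Longrightarrow> K' = K"
    using K by (auto simp: graph_component_def)
  have uw: "(u, w) \<in> rel (insert w K)" "(w, u) \<in> rel (insert w K)"
    using u sym by (auto simp: rel_def)
  have "rel K \<subseteq> rel (insert w K)" by (auto simp: rel_def)
  then have mono: "(rel K)\<^sup>* \<subseteq> (rel (insert w K))\<^sup>*" by (rule rtrancl_mono)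
  have old: "(x, y) \<in> (rel (insert w K))\<^sup>*" if "x \<in> K" "y \<in> K" for x y
    using K'(2) mono that unfolding graph_connected_def rel_def by blast
  have "(x, y) \<in> (rel (insert w K))\<^sup>*" if "x \<in> insert w K" "y \<in> insert w K" for x y
    using that old[of x y] old[of u y] old[of x u] uw u(1)
    by (auto intro: converse_rtrancl_into_rtrancl rtrancl_into_rtrancl)
  then have "graph_connected (insert w K) E"
    unfolding graph_connected_def rel_def by blast
  then have "insert w K = K" using K'(1,3) u(2) by blast
  then show ?thesis by blast
qed

text \<open>This supplies the strongly anticomplete pairs from which star cutsets are built.\<close>

lemma tri_component_strongly_antiadjacent:
  assumes T: "trigraph T" "X \<subseteq> verts T" and K: "tri_component (induced T X) K"
    and "u \<in> K" "w \<in> X - K"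
  shows "strongly_antiadjacent T u w"
proof (rule ccontr)
  assume neg: "\<not> strongly_antiadjacent T u w"
  have K': "graph_component X (adjacent (induced T X)) K" "K \<subseteq> X"
    using K by (auto simp: tri_component_def graph_component_def)
  then have "u \<noteq> w" "u \<in> X" "w \<in> X" using assms by auto
  then have "adjacent T u w" using neg not_adjacent_iff(4)[of T u w] T by blast
  then have "adjacent (induced T X) u w"
    using \<open>u \<in> X\<close> \<open>w \<in> X\<close> by (simp add: adjacent_def)
  then have "w \<in> K"
    using graph_component_closed[OF K'(1)] \<open>u \<in> K\<close> \<open>w \<in> X\<close> trigraph_relation_sym(4) by metis
  then show False using \<open>w \<in> X - K\<close> by blast
qed

section \<open>Shortest walks between two sets\<close>

lemma successively_take: "successively P xs \<Longrightarrow> successively P (take n xs)"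
  by (metis append_take_drop_id successively_append_iff)

lemma successively_drop: "successively P xs \<Longrightarrow> successively P (drop n xs)"
  by (metis append_take_drop_id successively_append_iff)

text \<open>A shortest walk is an induced path.\<close>

lemma induced_path_between:
  assumes T: "trigraph T" "X \<subseteq> verts T"
    and uw: "(u, w) \<in> {(x, y). x \<in> X \<and> y \<in> X \<and> adjacent T x y}\<^sup>*" "u \<in> X" "u \<in> A" "w \<in> B"
  obtains ps where "is_path T ps" "set ps \<subseteq> X" "hd ps \<in> A" "last ps \<in> B"
    "set (tl ps) \<inter> A = {}" "set (butlast ps) \<inter> B = {}"
proof -
  \<comment> \<open>The ends range over all of \<open>A\<close> and \<open>B\<close> instead of
    being fixed to \<open>u\<close> and \<open>w\<close>, so minimality also forces the walk to meet
    each set only at its end.\<close>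
  define walk where "walk ps \<longleftrightarrow> ps \<noteq> [] \<and> set ps \<subseteq> X \<and> successively (adjacent T) ps \<and>
    hd ps \<in> A \<and> last ps \<in> B" for ps
  have "\<exists>ps. ps \<noteq> [] \<and> set ps \<subseteq> X \<and> successively (adjacent T) ps \<and> hd ps = u \<and> last ps = w"
    using uw(1)
  proof (induction rule: rtrancl_induct)
    case base
    then show ?case using uw(2) by (intro exI[of _ "[u]"]) auto
  next
    case (step y z)
    then obtain ps where "ps \<noteq> []" "set ps \<subseteq> X" "successively (adjacent T) ps" "hd ps = u"
      "last ps = y" by blast
    then show ?case using step
      by (intro exI[of _ "ps @ [z]"]) (auto simp: successively_append_iff)
  qed
  then have "\<exists>ps. walk ps" using uw by (auto simp: walk_def)
  then obtain ps where ps: "walk ps" and min: "\<And>qs. walk qs \<Longrightarrow> length ps \<le> length qs"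
    using ex_has_least_nat[of walk _ length] by blast
  have p: "ps \<noteq> []" "set ps \<subseteq> X" "successively (adjacent T) ps" "hd ps \<in> A" "last ps \<in> B"
    using ps by (auto simp: walk_def)
  \<comment> \<open>An edge between non-consecutive vertices allows the vertices between them to be
    cut out.\<close>
  have shortcut: "False" if ij: "Suc i < j" "j < length ps" and "adjacent T (ps ! i) (ps ! j)" for i j
  proof -
    let ?q = "take (Suc i) ps @ drop j ps"
    have "last (take (Suc i) ps) = ps ! i" using ij by (simp add: take_Suc_conv_app_nth)
    moreover have "hd (drop j ps) = ps ! j" using ij by (simp add: hd_drop_conv_nth)
    ultimately have "successively (adjacent T) ?q"
      using that p(3) by (simp add: successively_append_iff successively_take successively_drop)
    moreover have "set ?q \<subseteq> X" using p(2) set_take_subset[of "Suc i" ps] set_drop_subset[of j ps] by auto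
    moreover have "hd ?q = hd ps" "last ?q = last ps" using ij p(1) by (auto simp: hd_append)
    ultimately have "walk ?q" using p ij by (auto simp: walk_def)
    then show False using min[of ?q] ij by simp
  qed
  have dist: "False" if ij: "i < j" "j < length ps" "ps ! i = ps ! j" for i j
  proof -
    let ?q = "take i ps @ drop j ps"
    have hd: "hd (drop j ps) = ps ! j" using ij by (simp add: hd_drop_conv_nth)
    have "adjacent T (last (take i ps)) (ps ! i)" if "i > 0"
    proof -
      have "take (Suc i) ps = take i ps @ [ps ! i]" using ij by (simp add: take_Suc_conv_app_nth)
      then have "successively (adjacent T) (take i ps @ [ps ! i])"
        using successively_take[OF p(3), of "Suc i"] by simp
      then show ?thesis using that p(1) by (auto simp: successively_append_iff)
    qed
    then have "successively (adjacent T) ?q"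
      using ij hd p(3) by (auto simp: successively_append_iff successively_take successively_drop)
    moreover have "set ?q \<subseteq> X" using p(2) set_take_subset[of i ps] set_drop_subset[of j ps] by auto
    \<comment> \<open>For \<open>i = 0\<close> the shortened walk starts at \<open>ps ! j\<close>,
      which equals the old first vertex.\<close>
    moreover have "hd ?q = hd ps"
      using ij hd p(1) by (cases i) (auto simp: hd_append hd_conv_nth)
    moreover have "last ?q = last ps" using ij by simp
    ultimately have "walk ?q" using p ij by (auto simp: walk_def)
    then show False using min[of ?q] ij by simp
  qed
  have "is_path T ps"
    unfolding is_path_def
  proof (intro conjI allI impI)
    show "distinct ps"
      unfolding distinct_conv_nth using dist by (metis linorder_neqE_nat)
    fix i j assume ij: "i < j \<and> j < length ps"
    show "if j - i = 1 then adjacent T (ps ! i) (ps ! j) else antiadjacent T (ps ! i) (ps ! j)"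
    proof (cases "j = Suc i")
      case True
      then show ?thesis using p(3) ij by (simp add: successively_conv_nth)
    next
      case False
      then have "Suc i < j" using ij by simp
      then have "\<not> adjacent T (ps ! i) (ps ! j)" using shortcut ij by blast
      moreover have "set ps \<subseteq> verts T" using p(2) T(2) by blast
      then have "ps ! i \<in> verts T" "ps ! j \<in> verts T" using ij by (simp_all add: subset_iff)
      moreover have "ps ! i \<noteq> ps ! j" using ij dist by blast
      ultimately have "antiadjacent T (ps ! i) (ps ! j)"
        using not_adjacent_iff(1)[OF T(1)] strongly_antiadjacent_imp by metis
      then show ?thesis using \<open>Suc i < j\<close> by auto
    qed
  qed (use p T in auto)
  moreover have "set (tl ps) \<inter> A = {}"
  proof (rule ccontr)
    assume "set (tl ps) \<inter> A \<noteq> {}"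
    then obtain i where i: "Suc i < length ps" "ps ! Suc i \<in> A"
      by (auto simp: in_set_conv_nth nth_tl less_diff_conv)
    have "hd (drop (Suc i) ps) = ps ! Suc i" using i by (simp add: hd_drop_conv_nth)
    then have "walk (drop (Suc i) ps)"
      using i p set_drop_subset[of "Suc i" ps] by (auto simp: walk_def successively_drop)
    then show False using min[of "drop (Suc i) ps"] i by simp
  qed
  moreover have "set (butlast ps) \<inter> B = {}"
  proof (rule ccontr)
    assume "set (butlast ps) \<inter> B \<noteq> {}"
    then obtain i where i: "Suc i < length ps" "ps ! i \<in> B"
      by (auto simp: in_set_conv_nth nth_butlast less_diff_conv)
    have "last (take (Suc i) ps) = ps ! i" using i by (simp add: take_Suc_conv_app_nth)
    then have "walk (take (Suc i) ps)"
      using i p set_take_subset[of "Suc i" ps] by (auto simp: walk_def successively_take)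
    then show False using min[of "take (Suc i) ps"] i by simp
  qed
  ultimately show ?thesis using that p by blast
qed

section \<open>Degrees in the graph of switchable pairs\<close>

text \<open>A third switchable neighbour would put three edges into the component of
  \<open>v\<close>. The set equation is the form in which the degree-two clause of
  \<open>trigraph_class_F\<close> applies.\<close>

lemma switchable_degree_le_2:
  assumes T: "T \<in> trigraph_class_F" and xy: "x \<noteq> y" "switchable T v x" "switchable T v y"
  shows "{u. switchable T v u} = {x, y}"
proof (rule ccontr)
  assume "{u. switchable T v u} \<noteq> {x, y}"
  then obtain z where z: "switchable T v z" "z \<noteq> x" "z \<noteq> y" using xy by auto
  have fin: "finite (verts T)" using T by (auto simp: trigraph_class_F_def trigraph_def)
  have "v \<in> verts T" using xy by (auto simp: switchable_def)
  then obtain K where K: "graph_component (verts T) (switchable T) K" "v \<in> K"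
    using graph_component_exists[of v "verts T" "switchable T"] trigraph_relation_sym(3) by metis
  have KV: "K \<subseteq> verts T" using K by (simp add: graph_component_def)
  have "u \<in> K" if "switchable T v u" for u
    using graph_component_closed[OF K(1)] K(2) that trigraph_relation_sym(3)
    by (metis switchable_def)
  then have mem: "x \<in> K" "y \<in> K" "z \<in> K" using xy z by auto
  let ?S = "{{u, v} | u v. u \<in> K \<and> v \<in> K \<and> switchable T u v}"
  have "?S \<subseteq> Pow K" by auto
  then have "finite ?S" using fin KV by (meson finite_Pow_iff finite_subset)
  moreover have "{{v, x}, {v, y}, {v, z}} \<subseteq> ?S" using mem xy z K(2) by auto
  ultimately have "card {{v, x}, {v, y}, {v, z}} \<le> card ?S" by (rule card_mono)
  moreover have "card {{v, x}, {v, y}, {v, z}} = 3"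
    using xy z by (auto simp: doubleton_eq_iff card_insert_if)
  ultimately show False using T K(1) by (auto simp: trigraph_class_F_def)
qed

section \<open>2-joins\<close>

lemma two_join_split_swap_ends:
  "two_join_split T X1 X2 A1 B1 C1 A2 B2 C2 \<Longrightarrow> two_join_split T X1 X2 B1 A1 C1 B2 A2 C2"
proof -
  have "two_join_side T X A B C \<Longrightarrow> two_join_side T X B A C" for X A B C
    unfolding two_join_side_def
    by (auto simp: insert_commute trigraph_relation_sym(4))
  then show "two_join_split T X1 X2 A1 B1 C1 A2 B2 C2 \<Longrightarrow> two_join_split T X1 X2 B1 A1 C1 B2 A2 C2"
    unfolding two_join_split_def by (auto simp: disjnt_def Int_commute)
qed

lemma two_join_split_swap_sides:
  assumes "two_join_split T X1 X2 A1 B1 C1 A2 B2 C2"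
  shows "two_join_split T X2 X1 A2 B2 C2 A1 B1 C1"
proof -
  have "\<forall>u\<in>X2. \<forall>v\<in>X1. \<not> switchable T u v"
    using assms unfolding two_join_split_def by (metis trigraph_relation_sym(3))
  moreover have "\<forall>u\<in>X2. \<forall>v\<in>X1. \<not> (u \<in> A2 \<and> v \<in> A1) \<and> \<not> (u \<in> B2 \<and> v \<in> B1) \<longrightarrow>
        strongly_antiadjacent T u v"
    using assms unfolding two_join_split_def by (metis trigraph_relation_sym(2))
  ultimately show ?thesis
    using assms unfolding two_join_split_def
    by (auto simp: disjnt_def Int_commute strongly_complete_sym)
qed

text \<open>These are the numbered facts \<open>d\<close> of the later proofs; 15 to 19 describe
  every pair between the two sides.\<close>

lemma two_join_splitD:
  assumes "two_join_split T X1 X2 A1 B1 C1 A2 B2 C2"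
  shows "verts T = X1 \<union> X2" "X1 \<inter> X2 = {}" "X1 = A1 \<union> B1 \<union> C1" "X2 = A2 \<union> B2 \<union> C2"
    "A1 \<noteq> {}" "B1 \<noteq> {}" "A2 \<noteq> {}" "B2 \<noteq> {}" "A1 \<inter> B1 = {}" "A1 \<inter> C1 = {}" "B1 \<inter> C1 = {}"
    "A2 \<inter> B2 = {}" "A2 \<inter> C2 = {}" "B2 \<inter> C2 = {}"
    "strongly_complete T A1 A2" "strongly_complete T B1 B2"
    "strongly_anticomplete T A1 (B2 \<union> C2)" "strongly_anticomplete T B1 (A2 \<union> C2)"
    "strongly_anticomplete T C1 (A2 \<union> B2 \<union> C2)"
proof -
  show "verts T = X1 \<union> X2" "X1 \<inter> X2 = {}" and X: "X1 = A1 \<union> B1 \<union> C1" "X2 = A2 \<union> B2 \<union> C2"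
    and "A1 \<noteq> {}" "B1 \<noteq> {}" "A2 \<noteq> {}" "B2 \<noteq> {}"
    and "strongly_complete T A1 A2" "strongly_complete T B1 B2"
    and disj: "A1 \<inter> B1 = {}" "A1 \<inter> C1 = {}" "B1 \<inter> C1 = {}"
      "A2 \<inter> B2 = {}" "A2 \<inter> C2 = {}" "B2 \<inter> C2 = {}"
    using assms by (auto simp: two_join_split_def two_join_side_def disjnt_def)
  have *: "\<forall>u\<in>X1. \<forall>v\<in>X2. \<not> (u \<in> A1 \<and> v \<in> A2) \<and> \<not> (u \<in> B1 \<and> v \<in> B2) \<longrightarrow>
        strongly_antiadjacent T u v"
    using assms by (simp add: two_join_split_def)
  show "strongly_anticomplete T A1 (B2 \<union> C2)" "strongly_anticomplete T B1 (A2 \<union> C2)"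
    "strongly_anticomplete T C1 (A2 \<union> B2 \<union> C2)"
    unfolding strongly_anticomplete_def
    by (intro ballI *[rule_format]; use X disj in auto)+
qed

text \<open>A component \<open>K\<close> missing \<open>A1\<close> lies in \<open>B1\<close> and
  \<open>C1\<close>, so outside itself it can have neighbours only in \<open>B2\<close>. A vertex of
  \<open>B1\<close> together with \<open>B2\<close> is then a star cutset, unless removing that
  vertex empties \<open>K\<close>.\<close>

lemma two_join_component_meets:
  assumes T: "trigraph T" "Berge T" "\<nexists>A B. balanced_skew_partition T A B"
    and split: "two_join_split T X1 X2 A1 B1 C1 A2 B2 C2" and card: "card X1 \<ge> 4"
    and K: "tri_component (induced T X1) K"
  shows "K \<inter> A1 \<noteq> {}"
proof
  assume KA: "K \<inter> A1 = {}"
  note d = two_join_splitD[OF split]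
  have K': "K \<subseteq> X1" "K \<noteq> {}" using K by (auto simp: tri_component_def graph_component_def)
  have out: "strongly_antiadjacent T u w" if "u \<in> K" "w \<in> X1 - K" for u w
    using tri_component_strongly_antiadjacent[OF T(1) _ K that] d by auto
  have out2: "strongly_antiadjacent T u w" if "u \<in> K" "w \<in> A2 \<union> C2" for u w
    using that K' KA d(3) strongly_anticompleteD[OF d(18), of u w]
      strongly_anticompleteD[OF d(19), of u w] by auto
  show False
  proof (cases "\<exists>b\<in>B1. K - {b} \<noteq> {}")
    \<comment> \<open>The star at \<open>b\<close> separates \<open>K - {b}\<close> from a remainder
      that contains \<open>A1\<close>; \<open>b\<close> itself need not lie in
      \<open>K\<close>.\<close>
    case True
    then obtain b where b: "b \<in> B1" "K - {b} \<noteq> {}" by blast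
    have sub: "b \<in> verts T" "B2 \<subseteq> verts T" "K \<subseteq> verts T" "b \<notin> B2" "K \<inter> B2 = {}"
      using b(1) d(1-4) K'(1) by auto
    obtain a where "a \<in> A1" using d(5) by blast
    then have a: "a \<in> verts T - K - B2 - {b}" using b(1) d(1-4,9) KA by auto
    have "\<exists>A B. balanced_skew_partition T A B"
    proof (rule star_cutset_balanced[OF T(1,2), of b B2 "K - {b}" "verts T - K - B2 - {b}"])
      show "strongly_anticomplete T (K - {b}) (verts T - K - B2 - {b})"
        unfolding strongly_anticomplete_def
      proof (intro ballI)
        fix u w assume "u \<in> K - {b}" "w \<in> verts T - K - B2 - {b}"
        then have "u \<in> K" "w \<in> X1 - K \<or> w \<in> A2 \<union> C2" using d(1,4) by auto
        then show "strongly_antiadjacent T u w" using out[of u w] out2[of u w] by blast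
      qed
      show "strongly_complete T {b} B2" using d(16) b by (auto simp: strongly_complete_def)
      show "verts T = insert b (B2 \<union> (K - {b}) \<union> (verts T - K - B2 - {b}))" using sub by auto
      show "verts T - K - B2 - {b} \<noteq> {}" using a by blast
    qed (use b sub d(8) in auto)
    then show False using T by blast
  \<comment> \<open>Now \<open>K = B1 = {b}\<close>, and \<open>b\<close> is strongly antiadjacent
    to the rest of \<open>X1\<close>. The star at \<open>a\<close> with leaves \<open>A2\<close>
    separates the rest of \<open>A1\<close> and \<open>C1\<close> from \<open>b\<close>,
    \<open>B2\<close> and \<open>C2\<close>.\<close>
  next
    case False
    then have single: "K = {b}" if "b \<in> B1" for b using K'(2) that by auto
    obtain b where "b \<in> B1" using d(6) by blast
    then have b: "K = {b}" "B1 = {b}" using single by auto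
    obtain a where a: "a \<in> A1" using d(5) by blast
    \<comment> \<open>The bound on \<open>card X1\<close> enters here: otherwise \<open>X1\<close>
      would have at most two vertices.\<close>
    have "A1 \<union> C1 - {a} \<noteq> {}"
    proof
      assume "A1 \<union> C1 - {a} = {}"
      then have "X1 \<subseteq> {a, b}" using d(3) b by auto
      then have "card X1 \<le> 2" using card_mono[of "{a, b}" X1] card_insert_le_m1[of 2 "{b}" a] by simp
      then show False using card by simp
    qed
    then have "\<exists>A B. balanced_skew_partition T A B"
    proof (intro star_cutset_balanced[OF T(1,2), of a A2 "A1 \<union> C1 - {a}" "insert b (B2 \<union> C2)"])
      have "strongly_antiadjacent T u b" if "u \<in> A1 \<union> C1" for u
        using out[of b u] that b d(3,9,11) trigraph_relation_sym(2)[of T u b] by auto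
      then show "strongly_anticomplete T (A1 \<union> C1 - {a}) (insert b (B2 \<union> C2))"
        using d(17,19) by (auto simp: strongly_anticomplete_def)
      show "strongly_complete T {a} A2" using d(15) a by (auto simp: strongly_complete_def)
    qed (use a b d(1-14) in auto)
    then show False using T by blast
  qed
qed

lemma proper_two_joinI:
  assumes T: "trigraph T" "Berge T" "\<nexists>A B. balanced_skew_partition T A B"
    and split: "two_join_split T X1 X2 A1 B1 C1 A2 B2 C2" and card: "card X1 \<ge> 4" "card X2 \<ge> 4"
  shows "proper_two_join T X1 X2"
proof -
  note sides = two_join_split_swap_sides[OF split]
  show ?thesis unfolding proper_two_join_def
    using split two_join_component_meets[OF T split card(1)]
      two_join_component_meets[OF T two_join_split_swap_ends[OF split] card(1)]
      two_join_component_meets[OF T sides card(2)]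
      two_join_component_meets[OF T two_join_split_swap_ends[OF sides] card(2)]
    by blast
qed

section \<open>Sides of a 2-join with three vertices\<close>

text \<open>Both \<open>x\<close> and \<open>x'\<close> must form a switchable pair with
  \<open>b\<close>, so \<open>b\<close> has degree two among switchable pairs. Membership in the
  class then makes \<open>b\<close> uniform towards all other vertices, but it is complete to
  \<open>B2\<close> and anticomplete to \<open>A2\<close>.\<close>

lemma two_join_side_not_2_1_0:
  assumes T: "T \<in> trigraph_class_F" "\<nexists>A B. balanced_skew_partition T A B"
    and split: "two_join_split T X1 X2 {x, x'} {b} {} A2 B2 C2" and "x \<noteq> x'"
  shows False
proof -
  have T': "trigraph T" "Berge T" using T by (auto simp: trigraph_class_F_def)
  note d = two_join_splitD[OF split]
  have pair: "switchable T b a" if a: "{a, a'} = {x, x'}" for a a'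
  proof -
    have aa': "a \<noteq> a'" "a \<noteq> b" "a' \<noteq> b" using a d \<open>x \<noteq> x'\<close> by auto
    have cA2: "strongly_complete T {a} A2" "strongly_complete T {a'} A2"
      using d(15) a by (auto simp: strongly_complete_def)
    have aBC: "strongly_anticomplete T {a} (B2 \<union> C2)" "strongly_anticomplete T {a'} (B2 \<union> C2)"
      using d(17) a by (auto simp: strongly_anticomplete_def)
    \<comment> \<open>The star at \<open>a\<close> with leaves \<open>b\<close> and
      \<open>A2\<close> separates \<open>a'\<close> from \<open>B2\<close> and \<open>C2\<close>. In
      the antiadjacent case below, the star at \<open>a'\<close> with leaves \<open>A2\<close> cuts
      off \<open>a\<close>.\<close>
    have False if "strongly_adjacent T a b"
    proof -
      have "\<exists>A B. balanced_skew_partition T A B"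
        by (rule star_cutset_balanced[OF T', of a "insert b A2" "{a'}" "B2 \<union> C2"])
          (use a aa' d aBC cA2 that in \<open>auto simp: strongly_complete_def\<close>)
      then show False using T by blast
    qed
    moreover have False if "strongly_antiadjacent T a b"
    proof -
      have "\<exists>A B. balanced_skew_partition T A B"
        by (rule star_cutset_balanced[OF T', of a' A2 "{a}" "insert b (B2 \<union> C2)"])
          (use a aa' d aBC cA2 that in \<open>auto simp: strongly_anticomplete_def\<close>)
      then show False using T by blast
    qed
    moreover have "a \<in> verts T" "b \<in> verts T" using a d by auto
    ultimately show ?thesis
      using not_adjacent_iff(3)[OF T'(1), of a b] adjacent_cases(2)[of T a b]
        trigraph_relation_sym(3)[of T a b] aa' by blast
  qed
  have sw: "switchable T b x" "switchable T b x'"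
    using pair[of x x'] pair[of x' x] by auto
  have "{u. switchable T b u} = {x, x'}"
    using switchable_degree_le_2[OF T(1) \<open>x \<noteq> x'\<close> sw] .
  moreover have "b \<in> verts T" using d by auto
  ultimately have "strongly_complete T {b} (verts T - {b, x, x'}) \<or>
      strongly_anticomplete T {b} (verts T - {b, x, x'})"
    using T(1) \<open>x \<noteq> x'\<close> unfolding trigraph_class_F_def by blast
  moreover obtain a2 b2 where ab: "a2 \<in> A2" "b2 \<in> B2" using d by blast
  then have "a2 \<in> verts T - {b, x, x'}" "b2 \<in> verts T - {b, x, x'}" using d by auto
  moreover have "strongly_adjacent T b b2" "strongly_antiadjacent T b a2"
    using d(16,18) ab by (auto simp: strongly_complete_def strongly_anticomplete_def)
  ultimately show False
    unfolding strongly_complete_def strongly_anticomplete_def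
    by (metis insertI1 strongly_adjacent_imp strongly_antiadjacent_imp)
qed

text \<open>If \<open>a\<close> and \<open>b\<close> form a switchable pair with common neighbour \<open>c\<close>, an induced path through the
  other side of the 2-join closes up both through \<open>ab\<close> and through \<open>acb\<close>, and one of the two holes
  is odd.\<close>

lemma two_join_side_not_1_1_1:
  assumes T: "trigraph T" "Berge T" "\<nexists>A B. balanced_skew_partition T A B"
    and split: "two_join_split T X1 X2 {a} {b} {c} A2 B2 C2"
    and proper: "\<And>K. tri_component (induced T X2) K \<Longrightarrow> K \<inter> A2 \<noteq> {} \<and> K \<inter> B2 \<noteq> {}"
  shows False
proof -
  note d = two_join_splitD[OF split]
  have abc: "a \<noteq> b" "a \<noteq> c" "b \<noteq> c" "a \<in> verts T" "b \<in> verts T" "c \<in> verts T" using d by auto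
  \<comment> \<open>Without this edge, the star at \<open>b\<close> with leaves \<open>B2\<close>
    would cut off \<open>c\<close>; symmetrically for the edge \<open>cb\<close>.\<close>
  have "adjacent T c a"
  proof (rule ccontr)
    assume "\<not> adjacent T c a"
    then have "strongly_antiadjacent T c a" using not_adjacent_iff(1)[OF T(1), of c a] abc by blast
    then have "\<exists>A B. balanced_skew_partition T A B"
      by (intro star_cutset_balanced[OF T(1,2), of b B2 "{c}" "insert a (A2 \<union> C2)"])
        (use d in \<open>auto simp: strongly_anticomplete_def\<close>)
    then show False using T by blast
  qed
  moreover have "adjacent T c b"
  proof (rule ccontr)
    assume "\<not> adjacent T c b"
    then have "strongly_antiadjacent T c b" using not_adjacent_iff(1)[OF T(1), of c b] abc by blast
    then have "\<exists>A B. balanced_skew_partition T A B"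
      by (intro star_cutset_balanced[OF T(1,2), of a A2 "{c}" "insert b (B2 \<union> C2)"])
        (use d in \<open>auto simp: strongly_anticomplete_def\<close>)
    then show False using T by blast
  qed
  \<comment> \<open>With \<open>c\<close> adjacent to both ends, the excluded path of length two
    forces \<open>a\<close> and \<open>b\<close> to be adjacent.\<close>
  moreover have "two_join_side T X1 {a} {b} {c}" using split by (simp add: two_join_split_def)
  ultimately have adj: "adjacent T c a" "adjacent T c b" "adjacent T a b"
    using abc d(3) trigraph_relation_sym(4)[of T a c] unfolding two_join_side_def by auto
  have "\<not> strongly_adjacent T a b"
  proof
    assume "strongly_adjacent T a b"
    then have "\<exists>A B. balanced_skew_partition T A B"
      by (intro star_cutset_balanced[OF T(1,2), of a "insert b A2" "{c}" "B2 \<union> C2"])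
        (use d in \<open>auto simp: strongly_anticomplete_def strongly_complete_def\<close>)
    then show False using T by blast
  qed
  then have ab: "antiadjacent T a b" using adj(3) adjacent_cases by metis
  obtain a2 where a2: "a2 \<in> A2" using d by blast
  have "a2 \<in> X2" using a2 d by auto
  \<comment> \<open>Properness is used here: the component of \<open>a2\<close> in the second side
    reaches \<open>B2\<close>, which gives an induced path from \<open>A2\<close> to
    \<open>B2\<close>.\<close>
  then obtain K where K: "tri_component (induced T X2) K" "a2 \<in> K"
    using graph_component_exists[of a2 X2 "adjacent (induced T X2)"] trigraph_relation_sym(4)
    unfolding tri_component_def by (metis induced_simps(1))
  obtain b2 where b2: "b2 \<in> K" "b2 \<in> B2" using proper[OF K(1)] by blast
  have K': "K \<subseteq> X2" "graph_connected K (adjacent (induced T X2))"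
    using K by (auto simp: tri_component_def graph_component_def)
  then have "(a2, b2) \<in> {(x, y). x \<in> K \<and> y \<in> K \<and> adjacent (induced T X2) x y}\<^sup>*"
    using K b2 by (auto simp: graph_connected_def)
  moreover have "{(x, y). x \<in> K \<and> y \<in> K \<and> adjacent (induced T X2) x y} \<subseteq>
      {(x, y). x \<in> X2 \<and> y \<in> X2 \<and> adjacent T x y}"
    using K' d by (auto simp: adjacent_def)
  ultimately have "(a2, b2) \<in> {(x, y). x \<in> X2 \<and> y \<in> X2 \<and> adjacent T x y}\<^sup>*"
    using rtrancl_mono by blast
  moreover have "X2 \<subseteq> verts T" using d(1) by blast
  ultimately obtain ps where ps: "is_path T ps" "set ps \<subseteq> X2" "hd ps \<in> A2" "last ps \<in> B2"
    "set (tl ps) \<inter> A2 = {}" "set (butlast ps) \<inter> B2 = {}"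
    using induced_path_between[OF T(1) _ _ \<open>a2 \<in> X2\<close> a2 b2(2)] by metis
  have ne: "ps \<noteq> []" using ps by (simp add: is_path_def)
  have tl_ps: "tl ps \<noteq> []"
  proof
    assume "tl ps = []"
    then have "hd ps = last ps" using ne by (cases ps) auto
    then show False using ps(3,4) d(12) by auto
  qed
  have "is_path T (b # rev ps)"
  proof (rule is_path_Cons)
    have "set (tl (rev ps)) = set (butlast ps)" by (metis butlast_rev rev_rev_ident set_rev)
    moreover have "antiadjacent T b y" if "y \<in> set (butlast ps)" for y
    proof -
      have "y \<in> A2 \<union> C2" using that ps(2,6) d(4) in_set_butlastD[OF that] by auto
      then show ?thesis
        using strongly_anticompleteD[OF d(18), of b y] strongly_antiadjacent_imp[of T b y] by simp
    qed
    ultimately show "\<forall>y\<in>set (tl (rev ps)). antiadjacent T b y" by simp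
    show "adjacent T b (hd (rev ps))"
      using strongly_completeD[OF d(16), of b "last ps"] ps(4) strongly_adjacent_imp[of T b]
      by (simp add: hd_rev)
  qed (use is_path_rev[OF ps(1)] ps(2) d(2,3) in auto)
  then have path_b: "is_path T (ps @ [b])" using is_path_rev[of T "b # rev ps"] by simp
  have anti_a: "antiadjacent T a y" if "y \<in> set (tl ps)" for y
  proof -
    have "y \<in> B2 \<union> C2" using list.set_sel(2)[OF ne that] that ps(2,5) d(4) by auto
    then show ?thesis
      using strongly_anticompleteD[OF d(17), of a y] strongly_antiadjacent_imp[of T a y] by simp
  qed
  have adj_a: "adjacent T a (hd ps)"
    using strongly_completeD[OF d(15), of a "hd ps"] ps(3) strongly_adjacent_imp[of T a] by simp
  \<comment> \<open>The switchable pair \<open>ab\<close> serves as a non-edge here, and as an edge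
    in the odd case below.\<close>
  have path_ab: "is_path T (a # ps @ [b])"
    by (rule is_path_Cons[OF path_b]) (use ps(2) d(2,3) ne adj_a anti_a ab abc in auto)
  have anti_c: "antiadjacent T c y" if "y \<in> set ps" for y
    using that ps(2) d(4) strongly_anticompleteD[OF d(19), of c y] strongly_antiadjacent_imp[of T c y]
    by auto
  show False
  proof (cases "even (length ps)")
    case True
    \<comment> \<open>The path from \<open>a\<close> through \<open>ps\<close> to \<open>b\<close>
      has length \<open>length ps + 1\<close>, which is odd, and \<open>c\<close> closes it.\<close>
    have "no_odd_path T (set ps) {a, b}"
      by (rule no_odd_path_closing[OF T(2), of _ c]) (use adj anti_c in auto)
    moreover have "is_path T (a # ps @ [b]) \<and> odd (path_length (a # ps @ [b])) \<and>
        path_length (a # ps @ [b]) > 1 \<and> hd (a # ps @ [b]) \<in> {a, b} \<and> last (a # ps @ [b]) \<in> {a, b} \<and>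
        path_interior (a # ps @ [b]) \<subseteq> set ps"
      using path_ab ne True by (auto simp: butlast_append)
    ultimately show False unfolding no_odd_path_def by blast
  next
    case False
    have len: "length ps > 1" using tl_ps by (cases ps) auto
    \<comment> \<open>The path through \<open>ps\<close> to \<open>b\<close> has odd length
      \<open>length ps\<close>. Its ends \<open>hd ps\<close> and \<open>b\<close> are both adjacent
      to \<open>a\<close>, which closes it.\<close>
    have "no_odd_path T (set (tl ps)) {hd ps, b}"
      by (rule no_odd_path_closing[OF T(2), of _ a]) (use adj adj_a anti_a in auto)
    moreover have "is_path T (ps @ [b]) \<and> odd (path_length (ps @ [b])) \<and>
        path_length (ps @ [b]) > 1 \<and> hd (ps @ [b]) \<in> {hd ps, b} \<and> last (ps @ [b]) \<in> {hd ps, b} \<and>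
        path_interior (ps @ [b]) \<subseteq> set (tl ps)"
      using path_b ne False len by (auto simp: butlast_append)
    ultimately show False unfolding no_odd_path_def by blast
  qed
qed

text \<open>With three vertices, the sizes of \<open>A1\<close>, \<open>B1\<close>,
  \<open>C1\<close> can only be 2, 1, 0 or 1, 2, 0 or 1, 1, 1; exchanging the ends identifies the
  first two patterns.\<close>

lemma two_join_side_card:
  assumes T: "T \<in> trigraph_class_F" "\<nexists>A B. balanced_skew_partition T A B"
    and split: "two_join_split T X1 X2 A1 B1 C1 A2 B2 C2"
    and proper: "\<And>K. tri_component (induced T X2) K \<Longrightarrow> K \<inter> A2 \<noteq> {} \<and> K \<inter> B2 \<noteq> {}"
  shows "card X1 \<ge> 4"
proof (rule ccontr)
  assume "\<not> card X1 \<ge> 4"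
  moreover have "card X1 \<ge> 3" using split unfolding two_join_split_def two_join_side_def by blast
  ultimately have X1: "card X1 = 3" by simp
  have T': "trigraph T" "Berge T" using T by (auto simp: trigraph_class_F_def)
  note d = two_join_splitD[OF split]
  have "finite X1" using X1 by (intro card_ge_0_finite) simp
  then have fin: "finite A1" "finite B1" "finite C1" using d(3) by auto
  have "card X1 = card A1 + card B1 + card C1"
    unfolding d(3) using fin d(9-11) by (simp add: card_Un_disjoint Int_Un_distrib2)
  moreover have "card A1 \<noteq> 0" "card B1 \<noteq> 0" using fin d(5,6) by auto
  ultimately consider "card A1 = 2" "card B1 = 1" "card C1 = 0"
    | "card A1 = 1" "card B1 = 2" "card C1 = 0" | "card A1 = 1" "card B1 = 1" "card C1 = 1"
    using X1 by linarith
  then show False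
  proof cases
    case 1
    then obtain x x' b where "A1 = {x, x'}" "x \<noteq> x'" "B1 = {b}" "C1 = {}"
      using fin by (auto simp: card_2_iff card_1_singleton_iff)
    then show False using two_join_side_not_2_1_0[OF T] split by metis
  next
    case 2
    then obtain x x' b where "B1 = {x, x'}" "x \<noteq> x'" "A1 = {b}" "C1 = {}"
      using fin by (auto simp: card_2_iff card_1_singleton_iff)
    then show False using two_join_side_not_2_1_0[OF T] two_join_split_swap_ends[OF split] by metis
  next
    case 3
    then obtain a b c where "A1 = {a}" "B1 = {b}" "C1 = {c}"
      by (auto simp: card_1_singleton_iff)
    then show False using two_join_side_not_1_1_1[OF T'(1,2) T(2)] split proper by metis
  qed
qed

section \<open>Homogeneous pairs\<close>

text \<open>The case \<open>C1 = D1 = {}\<close> of a weak fragment without the size bounds. The two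
  conditions on unions make \<open>A2\<close>, \<open>B2\<close>, \<open>C2\<close>,
  \<open>D2\<close> pairwise disjoint, in a form that survives both exchanging the ends and
  complementation.\<close>

definition homogeneous_split ::
    "'a trigraph \<Rightarrow> 'a set \<Rightarrow> 'a set \<Rightarrow> 'a set \<Rightarrow> 'a set \<Rightarrow> 'a set \<Rightarrow> 'a set \<Rightarrow> bool" where
  "homogeneous_split T A1 B1 A2 B2 C2 D2 \<longleftrightarrow>
     verts T = A1 \<union> B1 \<union> (A2 \<union> B2 \<union> C2 \<union> D2) \<and> A1 \<inter> B1 = {} \<and>
     (A1 \<union> B1) \<inter> (A2 \<union> B2 \<union> C2 \<union> D2) = {} \<and>
     (A2 \<union> D2) \<inter> (B2 \<union> C2) = {} \<and> (B2 \<union> D2) \<inter> (A2 \<union> C2) = {} \<and>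
     A1 \<noteq> {} \<and> B1 \<noteq> {} \<and> A2 \<noteq> {} \<and> B2 \<noteq> {} \<and> C2 \<noteq> {} \<and> D2 \<noteq> {} \<and>
     strongly_complete T A1 (A2 \<union> D2) \<and> strongly_anticomplete T A1 (B2 \<union> C2) \<and>
     strongly_complete T B1 (B2 \<union> D2) \<and> strongly_anticomplete T B1 (A2 \<union> C2)"

lemma homogeneous_split_swap:
  "homogeneous_split T A1 B1 A2 B2 C2 D2 \<Longrightarrow> homogeneous_split T B1 A1 B2 A2 C2 D2"
  unfolding homogeneous_split_def complement_simps by (simp add: Un_ac Int_ac)

lemma homogeneous_split_complement:
  "homogeneous_split T A1 B1 A2 B2 C2 D2 \<Longrightarrow> homogeneous_split (complement T) A1 B1 B2 A2 D2 C2"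
  unfolding homogeneous_split_def complement_simps by (simp add: Un_ac Int_ac)

text \<open>A path that leaves \<open>A1\<close> on both sides and avoids the vertices complete to \<open>A1\<close> starts and ends
  its interior in \<open>B1\<close>; a visit to \<open>B2\<close>, which is complete to \<open>B1\<close>, would force even length 4.\<close>

lemma odd_path_interior_in_B1:
  assumes hs: "homogeneous_split T A1 B1 A2 B2 C2 D2"
    and ps: "is_path T ps" "odd (path_length ps)" "path_length ps > 1"
    and ends: "hd ps \<in> A1" "last ps \<in> A1" and int: "path_interior ps \<subseteq> B1 \<union> B2 \<union> C2"
  shows "path_interior ps \<subseteq> B1"
proof -
  have h: "B1 \<inter> B2 = {}" "B1 \<inter> C2 = {}" "strongly_anticomplete T A1 (B2 \<union> C2)"
    "strongly_complete T B1 (B2 \<union> D2)" "strongly_anticomplete T B1 (A2 \<union> C2)"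
  proof -
    have "(A1 \<union> B1) \<inter> (A2 \<union> B2 \<union> C2 \<union> D2) = {}"
      using hs unfolding homogeneous_split_def by (elim conjE)
    then show "B1 \<inter> B2 = {}" "B1 \<inter> C2 = {}" by auto
  qed (use hs in \<open>simp_all add: homogeneous_split_def\<close>)
  obtain n where n: "length ps = n + 4" "even n" "hd ps = ps ! 0" "last ps = ps ! (n + 3)"
    "path_interior ps = (!) ps ` {1..n+2}"
    "\<And>i. i < n + 3 \<Longrightarrow> adjacent T (ps ! i) (ps ! Suc i)"
    "\<And>i j. Suc i < j \<Longrightarrow> j < n + 4 \<Longrightarrow> antiadjacent T (ps ! i) (ps ! j)"
    using odd_path_decompose[OF ps] by metis
  have inY: "ps ! i \<in> B1 \<union> B2 \<union> C2" if "1 \<le> i" "i \<le> n + 2" for i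
  proof -
    have "ps ! i \<in> path_interior ps" using that n(5) by auto
    then show ?thesis using int by blast
  qed
  have nbr: "y \<in> B1" if "adjacent T x y" "x \<in> A1" "y \<in> B1 \<union> B2 \<union> C2" for x y
    using that strongly_anticompleteD[OF h(3), of x y] strongly_antiadjacent_imp[of T x y] by auto
  have first: "ps ! 1 \<in> B1"
    using nbr[of "ps ! 0" "ps ! 1"] n(6)[of 0] ends(1) n(3) inY[of 1] by simp
  have "adjacent T (ps ! (n + 3)) (ps ! (n + 2))"
    using n(6)[of "n + 2"] trigraph_relation_sym(4)[of T "ps ! (n + 3)"] by (simp add: eval_nat_numeral)
  then have last: "ps ! (n + 2) \<in> B1"
    using nbr[of "ps ! (n + 3)" "ps ! (n + 2)"] ends(2) n(4) inY[of "n + 2"] by simp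
  have notB2: "ps ! i \<notin> B2" if i: "1 \<le> i" "i \<le> n + 2" for i
  proof
    assume B2: "ps ! i \<in> B2"
    then have "i \<noteq> 1" "i \<noteq> n + 2" using first last h(1) by auto
    have "\<not> antiadjacent T b (ps ! i)" "\<not> antiadjacent T (ps ! i) b" if "b \<in> B1" for b
      using strongly_completeD[OF h(4) that, of "ps ! i"] B2 strongly_adjacent_imp[of T b "ps ! i"]
        trigraph_relation_sym(5)[of T b "ps ! i"] by auto
    \<comment> \<open>Being strongly adjacent to the inner vertices \<open>1\<close> and
      \<open>n + 2\<close>, vertex \<open>i\<close> must be consecutive to both; so
      \<open>i = 2 = n + 1\<close>, against \<open>n\<close> even.\<close>
    then have "\<not> Suc 1 < i" "\<not> Suc i < n + 2"
      using n(7)[of 1 i] n(7)[of i "n + 2"] first last i by auto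
    then have "n = 1" using i \<open>i \<noteq> 1\<close> \<open>i \<noteq> n + 2\<close> by linarith
    then show False using n(2) by simp
  qed
  have "ps ! i \<in> B1" if "1 \<le> i" "i \<le> n + 2" for i
    using that
  proof (induction rule: dec_induct)
    case base
    then show ?case using first by simp
  next
    case (step i)
    then have "ps ! i \<in> B1" "adjacent T (ps ! i) (ps ! Suc i)" using n(6)[of i] by auto
    then have "ps ! Suc i \<notin> C2"
      using strongly_anticompleteD[OF h(5), of "ps ! i" "ps ! Suc i"]
        strongly_antiadjacent_imp[of T "ps ! i" "ps ! Suc i"] by auto
    then show ?case using inY[of "Suc i"] notB2[of "Suc i"] step by auto
  qed
  then show ?thesis using n(5) by auto
qed

text \<open>Such an \<open>a\<close> is strongly anticomplete to \<open>B1\<close>,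
  \<open>B2\<close> and \<open>C2\<close>, so it closes paths and antipaths between these sets and
  \<open>A2\<close>, \<open>D2\<close>. For the part \<open>A1 - {a}\<close> the closing vertex is
  some \<open>a2\<close> in \<open>A2\<close>, complete to \<open>A1\<close> and anticomplete to
  \<open>B1\<close>.\<close>

lemma homogeneous_split_has_neighbour:
  assumes T: "trigraph T" "Berge T" "\<nexists>A B. balanced_skew_partition T A B"
    and hs: "homogeneous_split T A1 B1 A2 B2 C2 D2" and card: "card (A1 \<union> B1) \<ge> 4" and a: "a \<in> A1"
  shows "\<exists>b\<in>B1. adjacent T a b"
proof (rule ccontr)
  assume no: "\<not> (\<exists>b\<in>B1. adjacent T a b)"
  have h: "verts T = A1 \<union> B1 \<union> (A2 \<union> B2 \<union> C2 \<union> D2)" "A1 \<inter> B1 = {}"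
    "(A1 \<union> B1) \<inter> (A2 \<union> B2 \<union> C2 \<union> D2) = {}"
    "(A2 \<union> D2) \<inter> (B2 \<union> C2) = {}" "(B2 \<union> D2) \<inter> (A2 \<union> C2) = {}"
    "A1 \<noteq> {}" "B1 \<noteq> {}" "A2 \<noteq> {}" "B2 \<noteq> {}" "C2 \<noteq> {}" "D2 \<noteq> {}"
    "strongly_complete T A1 (A2 \<union> D2)" "strongly_anticomplete T A1 (B2 \<union> C2)"
    "strongly_complete T B1 (B2 \<union> D2)" "strongly_anticomplete T B1 (A2 \<union> C2)"
    using hs unfolding homogeneous_split_def by simp_all
  have aB1: "strongly_antiadjacent T a b" if "b \<in> B1" for b
  proof -
    have "a \<in> verts T" "b \<in> verts T" "a \<noteq> b" using h(1,2) a that by auto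
    then show ?thesis using not_adjacent_iff(1)[OF T(1), of a b] no that by blast
  qed
  \<comment> \<open>If \<open>A1 = {a}\<close>, the star at \<open>b\<close> with leaves
    \<open>B2\<close> and \<open>D2\<close> separates the rest of \<open>B1\<close> from
    \<open>a\<close>, \<open>A2\<close> and \<open>C2\<close>.\<close>
  have "\<exists>A B. balanced_skew_partition T A B"
  proof (cases "A1 = {a}")
    case True
    obtain b where b: "b \<in> B1" using h(7) by blast
    have "B1 - {b} \<noteq> {}"
    proof
      assume "B1 - {b} = {}"
      then have "A1 \<union> B1 \<subseteq> {a, b}" using True by auto
      then have "card (A1 \<union> B1) \<le> card {a, b}" by (intro card_mono) auto
      also have "\<dots> \<le> 2" by (simp add: card_insert_if)
      finally show False using card by simp
    qed
    moreover have "strongly_anticomplete T (B1 - {b}) (insert a (A2 \<union> C2))"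
      using h(15) aB1 trigraph_relation_sym(2)[of T a] by (auto simp: strongly_anticomplete_def)
    moreover have "strongly_complete T {b} (B2 \<union> D2)"
      using h(14) b by (auto simp: strongly_complete_def)
    ultimately show ?thesis
      using True b h(1-11)
      by (intro star_cutset_balanced[OF T(1,2), of b "B2 \<union> D2" "B1 - {b}" "insert a (A2 \<union> C2)"]) auto
  next
    case False
    let ?Y = "B1 \<union> B2 \<union> C2"
    obtain a2 where a2: "a2 \<in> A2" using h(8) by blast
    have a_Y: "strongly_antiadjacent T a y" if "y \<in> ?Y" for y
      using that aB1 strongly_anticompleteD[OF h(13) a] by auto
    have a_adj: "\<forall>p\<in>A2 \<union> D2. adjacent T a p" and a_anti: "\<forall>y\<in>?Y. antiadjacent T a y"
      using strongly_completeD[OF h(12) a] strongly_adjacent_imp[of T a]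
        a_Y strongly_antiadjacent_imp[of T a] by auto
    have "strongly_adjacent T a2 p" if "p \<in> A1" for p
      using strongly_completeD[OF h(12) that, of a2] a2 trigraph_relation_sym(1)[of T p a2] by simp
    then have a2_adj: "\<forall>p\<in>A1 - {a}. adjacent T a2 p" using strongly_adjacent_imp[of T a2] by auto
    have "strongly_antiadjacent T a2 y" if "y \<in> B1" for y
      using strongly_anticompleteD[OF h(15) that, of a2] a2 trigraph_relation_sym(2)[of T y a2] by simp
    then have a2_anti: "\<forall>y\<in>B1. antiadjacent T a2 y" using strongly_antiadjacent_imp[of T a2] by auto
    have paths: "no_odd_path T ?Y (A1 - {a})"
      unfolding no_odd_path_def
    proof (rule notI, elim exE conjE)
      fix ps assume ps: "is_path T ps" "odd (path_length ps)" "path_length ps > 1"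
        and ends: "hd ps \<in> A1 - {a}" "last ps \<in> A1 - {a}" "path_interior ps \<subseteq> ?Y"
      \<comment> \<open>The vertex \<open>a2\<close> is known to be antiadjacent only to
        \<open>B1\<close>, so the interior has to be confined to \<open>B1\<close> before
        closing.\<close>
      have "path_interior ps \<subseteq> B1" using odd_path_interior_in_B1[OF hs ps] ends by blast
      then show False
        using no_odd_path_closing[OF T(2) a2_adj a2_anti] ps ends unfolding no_odd_path_def by blast
    qed
    have antipaths: "no_odd_path (complement T) (A1 - {a}) ?Y"
      unfolding no_odd_path_def
    proof (rule notI, elim exE conjE)
      fix ps assume ps: "is_path (complement T) ps" "odd (path_length ps)" "path_length ps > 1"
        and ends: "hd ps \<in> ?Y" "last ps \<in> ?Y" and int: "path_interior ps \<subseteq> A1 - {a}"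
      obtain n where n: "hd ps = ps ! 0" "last ps = ps ! (n + 3)"
        "path_interior ps = (!) ps ` {1..n+2}"
        "\<And>i j. Suc i < j \<Longrightarrow> j < n + 4 \<Longrightarrow> antiadjacent (complement T) (ps ! i) (ps ! j)"
        using odd_path_decompose[OF ps] by metis
      have "ps ! 1 \<in> path_interior ps" "ps ! (n + 2) \<in> path_interior ps" using n(3) by auto
      then have inA: "ps ! 1 \<in> A1" "ps ! (n + 2) \<in> A1" using int by auto
      \<comment> \<open>Each end of the antipath is adjacent in \<open>T\<close> to the inner vertex
        farthest from it, which lies in \<open>A1\<close>. Within \<open>B1\<close>,
        \<open>B2\<close>, \<open>C2\<close> only \<open>B1\<close> offers such neighbours, so both
        ends lie in \<open>B1\<close>.\<close>
      have "adjacent T (ps ! (n + 2)) (hd ps)" "adjacent T (ps ! 1) (last ps)"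
        using n(4)[of 0 "n + 2"] n(4)[of 1 "n + 3"] n(1,2) trigraph_relation_sym(4)[of T "hd ps"]
        by auto
      moreover have "y \<in> B1" if "adjacent T x y" "x \<in> A1" "y \<in> ?Y" for x y
        using that strongly_anticompleteD[OF h(13), of x y] strongly_antiadjacent_imp[of T x y] by auto
      ultimately have "hd ps \<in> B1" "last ps \<in> B1" using ends inA by metis+
      then show False
        using no_odd_antipath_closing[OF T(2) a2_adj a2_anti] ps int unfolding no_odd_path_def by blast
    qed
    have "balanced_skew_partition T ({a} \<union> ?Y) ((A1 - {a}) \<union> (A2 \<union> D2))"
    proof (rule balanced_skew_partitionI)
      show "verts T = {a} \<union> ?Y \<union> ((A1 - {a}) \<union> (A2 \<union> D2))" using h(1) a by auto
      show "({a} \<union> ?Y) \<inter> ((A1 - {a}) \<union> (A2 \<union> D2)) = {}" using h(2-5) a by auto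
      show "A1 - {a} \<noteq> {}" using False a by auto
      show "strongly_anticomplete T {a} ?Y" using a_Y by (simp add: strongly_anticomplete_def)
      show "strongly_complete T (A1 - {a}) (A2 \<union> D2)"
        using h(12) by (auto simp: strongly_complete_def)
    qed (use h(7,8) paths antipaths no_odd_path_singleton no_odd_path_closing[OF T(2) a_adj a_anti]
        no_odd_antipath_closing[OF T(2) a_adj a_anti] in simp_all)
    then show ?thesis by blast
  qed
  then show False using T by blast
qed

section \<open>Weak and proper fragments\<close>

text \<open>Negating \<open>theta\<close> exchanges connected and anticonnected sets as long as its
  values are -1, 0 or 1, which is known only on \<open>verts T\<close>. If \<open>A\<close> and
  \<open>B\<close> do not cover \<open>verts T\<close>, both sides are false.\<close>

lemma balanced_skew_partition_complement:
  "balanced_skew_partition (complement T) B A \<longleftrightarrow> balanced_skew_partition T A B" if "trigraph T"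
proof -
  have conn: "graph_connected X E = graph_connected X E'"
    if "\<And>u v. u \<in> X \<Longrightarrow> v \<in> X \<Longrightarrow> E u v = E' u v" for X :: "'a set" and E E'
  proof -
    have "{(x, y). x \<in> X \<and> y \<in> X \<and> E x y} = {(x, y). x \<in> X \<and> y \<in> X \<and> E' x y}"
      by (auto simp: that)
    then show ?thesis by (simp add: graph_connected_def)
  qed
  have "skew_partition (complement T) B A \<longleftrightarrow> skew_partition T A B"
  proof (cases "A \<union> B = verts T")
    case True
    have th: "theta T {u, v} \<in> {-1, 0, 1}" if "u \<in> A \<union> B" "v \<in> A \<union> B" "u \<noteq> v" for u v
      using \<open>trigraph T\<close> True that unfolding trigraph_def by blast
    have "tri_connected (complement T) B = tri_anticonnected T B"
      unfolding tri_connected_def tri_anticonnected_def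
    proof (rule conn)
      fix u v assume "u \<in> B" "v \<in> B"
      then show "adjacent (induced (complement T) B) u v = (u \<noteq> v \<and> \<not> strongly_adjacent (induced T B) u v)"
        using th[of u v] by (auto simp: adjacent_def strongly_adjacent_def complement_def)
    qed
    moreover have "tri_anticonnected (complement T) A = tri_connected T A"
      unfolding tri_connected_def tri_anticonnected_def
    proof (rule conn)
      fix u v assume "u \<in> A" "v \<in> A"
      then show "(u \<noteq> v \<and> \<not> strongly_adjacent (induced (complement T) A) u v) = adjacent (induced T A) u v"
        using th[of u v] by (auto simp: adjacent_def strongly_adjacent_def complement_def)
    qed
    ultimately show ?thesis using True by (auto simp: skew_partition_def)
  next
    case False
    then show ?thesis by (auto simp: skew_partition_def)
  qed
  then show ?thesis
    unfolding balanced_skew_partition_iff complement_simps by auto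
qed

text \<open>Switchable pairs stay the same, and the two alternatives for a vertex of degree two
  change places.\<close>

lemma trigraph_class_F_complement:
  "complement T \<in> trigraph_class_F" if "T \<in> trigraph_class_F"
  using that
  unfolding trigraph_class_F_def mem_Collect_eq complement_simps trigraph_complement Berge_complement
  by (subst disj_commute)

lemma weak_fragmentE:
  assumes "weak_fragment T X"
  obtains A1 B1 C1 D1 A2 B2 C2 D2 where "X \<subseteq> verts T"
    "pairwise_disjoint [A1, B1, C1, D1, A2, B2, C2, D2]"
    "X = A1 \<union> B1 \<union> C1 \<union> D1" "verts T - X = A2 \<union> B2 \<union> C2 \<union> D2"
    "strongly_complete T A1 (A2 \<union> D2)" "strongly_anticomplete T A1 (B2 \<union> C2)"
    "strongly_complete T B1 (B2 \<union> D2)" "strongly_anticomplete T B1 (A2 \<union> C2)"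
    "strongly_anticomplete T C1 (A2 \<union> B2 \<union> C2)" "strongly_complete T D1 (A2 \<union> B2 \<union> D2)"
    "card X \<ge> 4" "card (verts T - X) \<ge> 4"
    "card A1 \<ge> 1" "card B1 \<ge> 1" "card A2 \<ge> 1" "card B2 \<ge> 1"
    "C1 = {} \<and> D1 = {} \<and> C2 \<noteq> {} \<and> D2 \<noteq> {} \<or> D1 = {} \<and> D2 = {} \<or> C1 = {} \<and> C2 = {}"
  using assms unfolding weak_fragment_def by (elim conjE exE) (rule that; assumption)

lemma weak_fragment_complement:
  assumes "weak_fragment T X"
  shows "weak_fragment (complement T) X"
  using assms
proof (rule weak_fragmentE)
  fix A1 B1 C1 D1 A2 B2 C2 D2
  assume w: "X \<subseteq> verts T"
    "pairwise_disjoint [A1, B1, C1, D1, A2, B2, C2, D2]"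
    "X = A1 \<union> B1 \<union> C1 \<union> D1" "verts T - X = A2 \<union> B2 \<union> C2 \<union> D2"
    "strongly_complete T A1 (A2 \<union> D2)" "strongly_anticomplete T A1 (B2 \<union> C2)"
    "strongly_complete T B1 (B2 \<union> D2)" "strongly_anticomplete T B1 (A2 \<union> C2)"
    "strongly_anticomplete T C1 (A2 \<union> B2 \<union> C2)" "strongly_complete T D1 (A2 \<union> B2 \<union> D2)"
    "card X \<ge> 4" "card (verts T - X) \<ge> 4"
    "card A1 \<ge> 1" "card B1 \<ge> 1" "card A2 \<ge> 1" "card B2 \<ge> 1"
    "C1 = {} \<and> D1 = {} \<and> C2 \<noteq> {} \<and> D2 \<noteq> {} \<or> D1 = {} \<and> D2 = {} \<or> C1 = {} \<and> C2 = {}"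
  \<comment> \<open>In the complement \<open>A1\<close> is complete to \<open>B2\<close> and
    \<open>C2\<close>, so \<open>A2\<close> and \<open>B2\<close> change places, and so do the
    \<open>C\<close> and \<open>D\<close> parts on each side.\<close>
  have "pairwise_disjoint [A1, B1, D1, C1, B2, A2, D2, C2]"
    using w(2) by (auto simp: disjnt_def)
  moreover have "X = A1 \<union> B1 \<union> D1 \<union> C1" "verts T - X = B2 \<union> A2 \<union> D2 \<union> C2"
    "strongly_anticomplete T C1 (B2 \<union> A2 \<union> C2)" "strongly_complete T D1 (B2 \<union> A2 \<union> D2)"
    using w(3,4,9,10) by (auto simp: Un_ac)
  moreover have "D1 = {} \<and> C1 = {} \<and> D2 \<noteq> {} \<and> C2 \<noteq> {} \<or> C1 = {} \<and> C2 = {} \<or> D1 = {} \<and> D2 = {}"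
    using w(17) by blast
  ultimately show ?thesis
    unfolding weak_fragment_def complement_simps using w(1,5-8,11-16) by (intro conjI exI)
qed

text \<open>Four vertices on each side rule out the excluded path of length two.\<close>

lemma two_join_splitI:
  assumes "X \<subseteq> verts T" "pairwise_disjoint [A1, B1, C1, A2, B2, C2]"
    and X: "X = A1 \<union> B1 \<union> C1" "verts T - X = A2 \<union> B2 \<union> C2"
    and adj: "strongly_complete T A1 A2" "strongly_anticomplete T A1 (B2 \<union> C2)"
      "strongly_complete T B1 B2" "strongly_anticomplete T B1 (A2 \<union> C2)"
      "strongly_anticomplete T C1 (A2 \<union> B2 \<union> C2)"
    and "card X \<ge> 4" "card (verts T - X) \<ge> 4"
    and "A1 \<noteq> {}" "B1 \<noteq> {}" "A2 \<noteq> {}" "B2 \<noteq> {}"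
  shows "two_join_split T X (verts T - X) A1 B1 C1 A2 B2 C2"
proof -
  have side: "two_join_side T W A B C"
    if "W = A \<union> B \<union> C" "card W \<ge> 4" "A \<noteq> {}" "B \<noteq> {}" for W A B C
  proof -
    have "W \<noteq> {a, b, c}" for a b c
    proof
      assume "W = {a, b, c}"
      then have "card W \<le> 3" by (simp add: card_insert_if)
      then show False using that by simp
    qed
    then show ?thesis using that unfolding two_join_side_def by auto
  qed
  have cross: "strongly_adjacent T u v \<or> strongly_antiadjacent T u v"
      "\<not> (u \<in> A1 \<and> v \<in> A2) \<and> \<not> (u \<in> B1 \<and> v \<in> B2) \<Longrightarrow> strongly_antiadjacent T u v"
    if "u \<in> X" "v \<in> verts T - X" for u v
  proof -
    have "u \<in> A1 \<union> B1 \<union> C1" "v \<in> A2 \<union> B2 \<union> C2" using that X by auto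
    then show "strongly_adjacent T u v \<or> strongly_antiadjacent T u v"
      "\<not> (u \<in> A1 \<and> v \<in> A2) \<and> \<not> (u \<in> B1 \<and> v \<in> B2) \<Longrightarrow> strongly_antiadjacent T u v"
      using adj unfolding strongly_complete_def strongly_anticomplete_def by auto
  qed
  have "\<not> switchable T u v" if "u \<in> X" "v \<in> verts T - X" for u v
    using cross(1)[OF that]
    by (auto simp: switchable_def strongly_adjacent_def strongly_antiadjacent_def)
  then show ?thesis
    unfolding two_join_split_def using assms cross(2) side[of X A1 B1 C1]
      side[of "verts T - X" A2 B2 C2] by (intro conjI ballI impI) auto
qed

lemma proper_homogeneous_pairI:
  assumes T: "T \<in> trigraph_class_F" "\<nexists>A B. balanced_skew_partition T A B"
    and hs: "homogeneous_split T A1 B1 A2 B2 C2 D2" and card: "card (A1 \<union> B1) \<ge> 4"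
  shows "proper_homogeneous_pair T A1 B1"
proof -
  have T': "trigraph T" "Berge T" using T(1) by (auto simp: trigraph_class_F_def)
  have Tc: "trigraph (complement T)" "Berge (complement T)"
      "\<nexists>A B. balanced_skew_partition (complement T) A B"
    using T' T(2) balanced_skew_partition_complement[OF T'(1)] by auto
  have h: "verts T = A1 \<union> B1 \<union> (A2 \<union> B2 \<union> C2 \<union> D2)" "A1 \<inter> B1 = {}"
    "(A1 \<union> B1) \<inter> (A2 \<union> B2 \<union> C2 \<union> D2) = {}"
    "A1 \<noteq> {}" "B1 \<noteq> {}" "A2 \<noteq> {}" "B2 \<noteq> {}" "C2 \<noteq> {}" "D2 \<noteq> {}"
    "strongly_complete T A1 (A2 \<union> D2)" "strongly_anticomplete T A1 (B2 \<union> C2)"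
    "strongly_complete T B1 (B2 \<union> D2)" "strongly_anticomplete T B1 (A2 \<union> C2)"
    using hs unfolding homogeneous_split_def by simp_all
  have card': "card (B1 \<union> A1) \<ge> 4" using card by (simp add: Un_commute)
  note hsw = homogeneous_split_swap[OF hs]
  \<comment> \<open>Exchanging the ends gives the statements for \<open>B1\<close>; passing to the
    complement turns neighbours into antineighbours.\<close>
  have nbrs: "\<forall>a\<in>A1. (\<exists>b\<in>B1. adjacent T a b) \<and> (\<exists>b\<in>B1. antiadjacent T a b)"
    "\<forall>b\<in>B1. (\<exists>a\<in>A1. adjacent T b a) \<and> (\<exists>a\<in>A1. antiadjacent T b a)"
    using homogeneous_split_has_neighbour[OF T' T(2) hs card]
      homogeneous_split_has_neighbour[OF T' T(2) hsw card']
      homogeneous_split_has_neighbour[OF Tc homogeneous_split_complement[OF hs] card]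
      homogeneous_split_has_neighbour[OF Tc homogeneous_split_complement[OF hsw] card']
    by simp_all
  have fin: "finite A1" "finite B1"
    using T'(1) h(1) by (auto simp: trigraph_def)
  \<comment> \<open>If \<open>P\<close> were a single vertex, it would form a switchable pair with each of the at least three
    vertices of \<open>Q\<close>.\<close>
  have size: "card P > 1"
    if "finite P" "P \<noteq> {}" "finite Q" "card (P \<union> Q) \<ge> 4"
      and Q: "\<forall>q\<in>Q. (\<exists>p\<in>P. adjacent T q p) \<and> (\<exists>p\<in>P. antiadjacent T q p)" for P Q
  proof (rule ccontr)
    assume "\<not> card P > 1"
    then have "card P = 1" using that(1,2) card_gt_0_iff[of P] by linarith
    then obtain p where p: "P = {p}" by (auto simp: card_1_singleton_iff)
    have sw: "switchable T p q" if "q \<in> Q" for q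
      using Q that p trigraph_relation_sym(3)[of T p q]
      by (auto simp: adjacent_def antiadjacent_def switchable_def)
    have "card (P \<union> Q) \<le> Suc (card Q)" using p card_insert_le_m1 that(3) by (simp add: card_insert_if)
    then have "card Q \<ge> 3" using that(4) by simp
    then have "\<exists>Q'\<subseteq>Q. card Q' = 3" by (meson obtain_subset_with_card_n)
    then obtain x y z where xyz: "{x, y, z} \<subseteq> Q" "x \<noteq> y" "x \<noteq> z" "y \<noteq> z"
      by (auto simp: card_3_iff)
    have "{u. switchable T p u} = {x, y}"
      using switchable_degree_le_2[OF T(1) xyz(2)] sw xyz(1) by simp
    then show False using sw[of z] xyz by auto
  qed
  have "card A1 > 1" "card B1 > 1"
    using size[of A1 B1] size[of B1 A1] fin h(4,5) card card' nbrs by auto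
  define R where "R = verts T - (A1 \<union> B1)"
  have R: "R = A2 \<union> B2 \<union> C2 \<union> D2" using h(1,3) by (auto simp: R_def)
  have mem: "A2 \<union> D2 \<subseteq> {v \<in> R. strongly_complete T {v} A1}"
    "B2 \<union> C2 \<subseteq> {v \<in> R. strongly_anticomplete T {v} A1}"
    "B2 \<union> D2 \<subseteq> {v \<in> R. strongly_complete T {v} B1}"
    "A2 \<union> C2 \<subseteq> {v \<in> R. strongly_anticomplete T {v} B1}"
    unfolding R strongly_complete_sym[of T "{_}"] strongly_anticomplete_sym[of T "{_}"]
    using h(10-13) by (auto simp: strongly_complete_def strongly_anticomplete_def)
  obtain x y z w where "x \<in> A2" "y \<in> B2" "z \<in> C2" "w \<in> D2" using h(6-9) by blast
  show ?thesis
    unfolding proper_homogeneous_pair_def Let_def R_def[symmetric]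
  proof (intro conjI)
    show "{v \<in> R. strongly_complete T {v} A1} \<union> {v \<in> R. strongly_anticomplete T {v} A1} = R"
      "{v \<in> R. strongly_complete T {v} B1} \<union> {v \<in> R. strongly_anticomplete T {v} B1} = R"
      using mem R by blast+
    show "{v \<in> R. strongly_complete T {v} A1} \<inter> {v \<in> R. strongly_complete T {v} B1} \<noteq> {}"
      "{v \<in> R. strongly_complete T {v} A1} \<inter> {v \<in> R. strongly_anticomplete T {v} B1} \<noteq> {}"
      "{v \<in> R. strongly_anticomplete T {v} A1} \<inter> {v \<in> R. strongly_complete T {v} B1} \<noteq> {}"
      "{v \<in> R. strongly_anticomplete T {v} A1} \<inter> {v \<in> R. strongly_anticomplete T {v} B1} \<noteq> {}"
      using mem \<open>x \<in> A2\<close> \<open>y \<in> B2\<close> \<open>z \<in> C2\<close> \<open>w \<in> D2\<close> by blast+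
    show "A1 \<subseteq> verts T" "B1 \<subseteq> verts T" using h(1) by auto
  qed (fact h nbrs \<open>card A1 > 1\<close> \<open>card B1 > 1\<close>)+
qed

section \<open>From weak to proper fragments\<close>

lemma weak_fragment_imp_proper_fragment:
  assumes T: "T \<in> trigraph_class_F" "\<nexists>A B. balanced_skew_partition T A B"
    and weak: "weak_fragment T X"
  shows "proper_fragment T X"
  using weak
proof (rule weak_fragmentE)
  fix A1 B1 C1 D1 A2 B2 C2 D2
  assume sub: "X \<subseteq> verts T"
    and disj: "pairwise_disjoint [A1, B1, C1, D1, A2, B2, C2, D2]"
    and X: "X = A1 \<union> B1 \<union> C1 \<union> D1" "verts T - X = A2 \<union> B2 \<union> C2 \<union> D2"
    and adj: "strongly_complete T A1 (A2 \<union> D2)" "strongly_anticomplete T A1 (B2 \<union> C2)"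
    "strongly_complete T B1 (B2 \<union> D2)" "strongly_anticomplete T B1 (A2 \<union> C2)"
    "strongly_anticomplete T C1 (A2 \<union> B2 \<union> C2)" "strongly_complete T D1 (A2 \<union> B2 \<union> D2)"
    and card: "card X \<ge> 4" "card (verts T - X) \<ge> 4"
    and card1: "card A1 \<ge> 1" "card B1 \<ge> 1" "card A2 \<ge> 1" "card B2 \<ge> 1"
    and alt: "C1 = {} \<and> D1 = {} \<and> C2 \<noteq> {} \<and> D2 \<noteq> {} \<or> D1 = {} \<and> D2 = {} \<or> C1 = {} \<and> C2 = {}"
  have T': "trigraph T" "Berge T" using T(1) by (auto simp: trigraph_class_F_def)
  have ne: "A1 \<noteq> {}" "B1 \<noteq> {}" "A2 \<noteq> {}" "B2 \<noteq> {}" using card1 by auto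
  from alt consider "C1 = {}" "D1 = {}" "C2 \<noteq> {}" "D2 \<noteq> {}" | "D1 = {}" "D2 = {}"
    | "C1 = {}" "C2 = {}" by blast
  then show ?thesis
  proof cases
    case 1
    have XAB: "X = A1 \<union> B1" using X(1) 1 by simp
    then have "verts T = A1 \<union> B1 \<union> (A2 \<union> B2 \<union> C2 \<union> D2)" using sub X(2) by blast
    moreover have "A1 \<inter> B1 = {}" "(A1 \<union> B1) \<inter> (A2 \<union> B2 \<union> C2 \<union> D2) = {}"
      "(A2 \<union> D2) \<inter> (B2 \<union> C2) = {}" "(B2 \<union> D2) \<inter> (A2 \<union> C2) = {}"
      using disj by (simp_all add: disjnt_def Int_Un_distrib Int_Un_distrib2 Int_commute)
    ultimately have "homogeneous_split T A1 B1 A2 B2 C2 D2"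
      using adj(1-4) ne 1(3,4) unfolding homogeneous_split_def by (intro conjI)
    then have "proper_homogeneous_pair T A1 B1"
      using proper_homogeneous_pairI[OF T] card(1) XAB by simp
    then show ?thesis using sub XAB unfolding proper_fragment_def by blast
  next
    case 2
    have "two_join_split T X (verts T - X) A1 B1 C1 A2 B2 C2"
    proof (rule two_join_splitI[OF sub])
      show "pairwise_disjoint [A1, B1, C1, A2, B2, C2]" using disj by simp
      show "X = A1 \<union> B1 \<union> C1" "verts T - X = A2 \<union> B2 \<union> C2" using X 2 by blast+
      show "strongly_complete T A1 A2" "strongly_complete T B1 B2" using adj(1,3) 2 by simp_all
    qed (fact adj card ne)+
    then show ?thesis
      using proper_two_joinI[OF T' T(2) _ card] sub unfolding proper_fragment_def by blast
  next
    case 3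
    \<comment> \<open>In the complement the \<open>D\<close> parts play the role of the
      \<open>C\<close> parts, and \<open>A1\<close> is matched with \<open>B2\<close>,
      \<open>B1\<close> with \<open>A2\<close>.\<close>
    have "two_join_split (complement T) X (verts (complement T) - X) A1 B1 D1 B2 A2 D2"
    proof (rule two_join_splitI)
      show "pairwise_disjoint [A1, B1, D1, B2, A2, D2]"
        using disj by (simp add: disjnt_def Int_commute)
      show "X = A1 \<union> B1 \<union> D1" "verts (complement T) - X = B2 \<union> A2 \<union> D2"
        using X 3 by (simp_all add: Un_ac)
      show "strongly_complete (complement T) A1 B2" "strongly_complete (complement T) B1 A2"
        "strongly_anticomplete (complement T) A1 (A2 \<union> D2)"
        "strongly_anticomplete (complement T) B1 (B2 \<union> D2)"
        "strongly_anticomplete (complement T) D1 (B2 \<union> A2 \<union> D2)"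
        using adj 3 by (simp_all add: Un_ac)
      show "X \<subseteq> verts (complement T)" "card (verts (complement T) - X) \<ge> 4" using sub card by simp_all
    qed (fact card ne)+
    moreover have "\<nexists>A B. balanced_skew_partition (complement T) A B"
      using T(2) balanced_skew_partition_complement[OF T'(1)] by blast
    ultimately have "proper_complement_two_join T X (verts T - X)"
      unfolding proper_complement_two_join_def
      using T' card by (intro proper_two_joinI) auto
    then show ?thesis using sub unfolding proper_fragment_def by blast
  qed
qed

section \<open>From proper to weak fragments\<close>

text \<open>The parts of the 2-join serve with empty \<open>D\<close> parts. Properness of each side
  raises the size bound of the opposite side from three to four.\<close>

lemma proper_two_join_imp_weak_fragment:
  assumes T: "T \<in> trigraph_class_F" "\<nexists>A B. balanced_skew_partition T A B"
    and X: "X \<subseteq> verts T" and join: "proper_two_join T X (verts T - X)"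
  shows "weak_fragment T X"
proof -
  obtain A1 B1 C1 A2 B2 C2 where
    split: "two_join_split T X (verts T - X) A1 B1 C1 A2 B2 C2"
    and proper: "\<And>K. tri_component (induced T X) K \<Longrightarrow> K \<inter> A1 \<noteq> {} \<and> K \<inter> B1 \<noteq> {}"
      "\<And>K. tri_component (induced T (verts T - X)) K \<Longrightarrow> K \<inter> A2 \<noteq> {} \<and> K \<inter> B2 \<noteq> {}"
    using join unfolding proper_two_join_def by blast
  note d = two_join_splitD[OF split]
  have card: "card X \<ge> 4" "card (verts T - X) \<ge> 4"
    using two_join_side_card[OF T split proper(2)]
      two_join_side_card[OF T two_join_split_swap_sides[OF split] proper(1)] by auto
  have fin: "finite (verts T)" using T(1) by (auto simp: trigraph_class_F_def trigraph_def)
  then have "finite X" "finite (verts T - X)" using X finite_subset by auto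
  moreover have "A1 \<subseteq> X" "B1 \<subseteq> X" "A2 \<subseteq> verts T - X" "B2 \<subseteq> verts T - X"
    using d(3,4) by blast+
  ultimately have "finite A1" "finite B1" "finite A2" "finite B2" by (meson finite_subset)+
  then have card1: "card A1 \<ge> 1" "card B1 \<ge> 1" "card A2 \<ge> 1" "card B2 \<ge> 1"
    using d(5-8) by (auto simp: Suc_le_eq card_gt_0_iff)
  have "pairwise_disjoint [A1, B1, C1, A2, B2, C2]" using split unfolding two_join_split_def by blast
  then have "pairwise_disjoint [A1, B1, C1, {}, A2, B2, C2, {}]" by auto
  moreover have "strongly_complete T A1 (A2 \<union> {})" "strongly_complete T B1 (B2 \<union> {})"
    "strongly_complete T {} (A2 \<union> B2 \<union> {})"
    using d(15,16) by (auto simp: strongly_complete_def)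
  moreover have "X = A1 \<union> B1 \<union> C1 \<union> {}" "verts T - X = A2 \<union> B2 \<union> C2 \<union> {}" using d(3,4) by auto
  moreover have "C1 = {} \<and> {} = {} \<and> C2 \<noteq> {} \<and> {} \<noteq> {} \<or> {} = {} \<and> {} = {} \<or> C1 = {} \<and> C2 = {}"
    by simp
  ultimately show ?thesis
    unfolding weak_fragment_def using X card card1 d(17-19)
    by (intro conjI exI)
qed

text \<open>The outside splits into four nonempty quadrants by behaviour towards \<open>A\<close>
  and \<open>B\<close>, which gives its four vertices. In this proof \<open>A1\<close>,
  \<open>A2\<close>, \<open>B1\<close>, \<open>B2\<close> are sets of outside vertices, and the
  quadrants become the parts of the far side.\<close>

lemma proper_homogeneous_pair_imp_weak_fragment:
  assumes T: "trigraph T" and pair: "proper_homogeneous_pair T A B"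
  shows "weak_fragment T (A \<union> B)"
proof -
  define R where "R = verts T - (A \<union> B)"
  define A1 where "A1 = {v \<in> R. strongly_complete T {v} A}"
  define A2 where "A2 = {v \<in> R. strongly_anticomplete T {v} A}"
  define B1 where "B1 = {v \<in> R. strongly_complete T {v} B}"
  define B2 where "B2 = {v \<in> R. strongly_anticomplete T {v} B}"
  have p: "A \<subseteq> verts T" "B \<subseteq> verts T" "A \<inter> B = {}" "card A > 1" "card B > 1" "A1 \<union> A2 = R" "B1 \<union> B2 = R"
    "A1 \<inter> B1 \<noteq> {}" "A1 \<inter> B2 \<noteq> {}" "A2 \<inter> B1 \<noteq> {}" "A2 \<inter> B2 \<noteq> {}"
    using pair unfolding proper_homogeneous_pair_def Let_def A1_def A2_def B1_def B2_def R_def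
    by simp_all
  have fin: "finite (verts T)" using T by (simp add: trigraph_def)
  then have finR: "finite R" "finite A" "finite B" using p(1,2) finite_subset by (auto simp: R_def)
  have "A \<noteq> {}" "B \<noteq> {}" using p(4,5) by auto
  then have dis: "A1 \<inter> A2 = {}" "B1 \<inter> B2 = {}"
    by (auto simp: A1_def A2_def B1_def B2_def strongly_complete_def strongly_anticomplete_def
        strongly_adjacent_def strongly_antiadjacent_def)
  have "card (A \<union> B) = card A + card B" using finR p(3) by (simp add: card_Un_disjoint)
  then have cardX: "card (A \<union> B) \<ge> 4" using p(4,5) by simp
  obtain a b c d where abcd: "a \<in> A1 \<inter> B2" "b \<in> A2 \<inter> B1" "c \<in> A2 \<inter> B2" "d \<in> A1 \<inter> B1"
    using p(8-11) by blast
  then have "distinct [a, b, c, d]" using dis by auto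
  then have "card {a, b, c, d} = 4" by simp
  moreover have "card {a, b, c, d} \<le> card R" using abcd p(6) finR by (intro card_mono) auto
  ultimately have cardR: "card (verts T - (A \<union> B)) \<ge> 4" by (simp add: R_def)
  have complete: "strongly_complete T A A1" "strongly_complete T B B1"
    "strongly_anticomplete T A A2" "strongly_anticomplete T B B2"
    unfolding strongly_complete_sym[of T A] strongly_complete_sym[of T B]
      strongly_anticomplete_sym[of T A] strongly_anticomplete_sym[of T B]
    by (auto simp: A1_def A2_def B1_def B2_def strongly_complete_def strongly_anticomplete_def)
  have "R \<inter> (A \<union> B) = {}" by (auto simp: R_def)
  then have disj: "pairwise_disjoint [A, B, {}, {}, A1 \<inter> B2, A2 \<inter> B1, A2 \<inter> B2, A1 \<inter> B1]"
    using p(3,6,7) dis by (auto simp: disjnt_def)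
  have parts: "verts T - (A \<union> B) = (A1 \<inter> B2) \<union> (A2 \<inter> B1) \<union> (A2 \<inter> B2) \<union> (A1 \<inter> B1)"
    using p(6,7) by (auto simp: R_def)
  have adj: "strongly_complete T A (A1 \<inter> B2 \<union> A1 \<inter> B1)" "strongly_anticomplete T A (A2 \<inter> B1 \<union> A2 \<inter> B2)"
    "strongly_complete T B (A2 \<inter> B1 \<union> A1 \<inter> B1)" "strongly_anticomplete T B (A1 \<inter> B2 \<union> A2 \<inter> B2)"
    using complete by (auto simp: strongly_complete_def strongly_anticomplete_def)
  have "finite (A1 \<inter> B2)" "finite (A2 \<inter> B1)" using finR(1) p(6) by auto
  then have card1: "card A \<ge> 1" "card B \<ge> 1" "card (A1 \<inter> B2) \<ge> 1" "card (A2 \<inter> B1) \<ge> 1"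
    using p(4,5,9,10) finR(2,3) by (auto simp: Suc_le_eq card_gt_0_iff)
  show ?thesis
    unfolding weak_fragment_def
    by (rule conjI, use p(1,2) in blast, rule exI[of _ A], rule exI[of _ B], rule exI[of _ "{}"],
        rule exI[of _ "{}"], rule exI[of _ "A1 \<inter> B2"], rule exI[of _ "A2 \<inter> B1"],
        rule exI[of _ "A2 \<inter> B2"], rule exI[of _ "A1 \<inter> B1"])
      (use disj parts adj cardX cardR card1 p(8,11) in
        \<open>simp add: strongly_complete_def[of T "{}"] strongly_anticomplete_def[of T "{}"]\<close>)
qed

theorem theorem10p1:
  fixes T :: "'a trigraph" and X :: "'a set"
  assumes "T \<in> trigraph_class_F"
    and "\<not> (\<exists>A B. balanced_skew_partition T A B)"
    and "X \<subseteq> verts T"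
  shows "weak_fragment T X \<longleftrightarrow> proper_fragment T X"
proof
  assume "weak_fragment T X"
  then show "proper_fragment T X" using weak_fragment_imp_proper_fragment assms by blast
next
  have T: "trigraph T" using assms(1) by (simp add: trigraph_class_F_def)
  have noc: "\<nexists>A B. balanced_skew_partition (complement T) A B"
    using assms(2) balanced_skew_partition_complement[OF T] by blast
  assume "proper_fragment T X"
  then consider "proper_two_join T X (verts T - X)"
    | "proper_two_join (complement T) X (verts (complement T) - X)"
    | A B where "proper_homogeneous_pair T A B" "X = A \<union> B"
    unfolding proper_fragment_def proper_complement_two_join_def complement_simps by blast
  then show "weak_fragment T X"
  proof cases
    case 1
    then show ?thesis using proper_two_join_imp_weak_fragment assms by blast
  next
    case 2
    then have "weak_fragment (complement T) X"
      using proper_two_join_imp_weak_fragment[OF trigraph_class_F_complement[OF assms(1)] noc]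
        assms(3) by simp
    \<comment> \<open>Complementation is an involution, so the weak fragment of the complement is
      carried back to \<open>T\<close>.\<close>
    then show ?thesis using weak_fragment_complement by fastforce
  next
    case 3
    then show ?thesis using proper_homogeneous_pair_imp_weak_fragment[OF T] by blast
  qed
qed

end
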